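(* Let $n\ge1$ and $p,q,r,s\ge0$ be integers, and let $\boldsymbol{x}=(x_1,\dots,x_{2n})$, $\boldsymbol{a}=(a_1,\dots,a_{2n})$, $\boldsymbol{b}=(b_1,\dots,b_{2n})$, $\boldsymbol{z}=(z_1,\dots,z_{p+q})$, $\boldsymbol{c}=(c_1,\dots,c_{p+q})$, $\boldsymbol{w}=(w_1,\dots,w_{r+s})$, $\boldsymbol{d}=(d_1,\dots,d_{r+s})$ be indeterminates. Then $$ \operatorname{Pf}\left(\frac{F^{p+1,q+1}(x_i,x_j,\boldsymbol{z};a_i,a_j,\boldsymbol{c})\,F^{r+1,s+1}(x_i,x_j,\boldsymbol{w};b_i,b_j,\boldsymbol{d})}{(x_j-x_i)(1-x_ix_j)}\right)_{1\le i,j\le 2n} $$ $$ =\frac{1}{\prod_{1\le i<j\le 2n}(x_j-x_i)(1-x_ix_j)}\,F^{p,q}(\boldsymbol z;\boldsymbol c)^{n-1}F^{r,s}(\boldsymbol w;\boldsymbol d)^{n-1}\,F^{n+p,n+q}(\boldsymbol x,\boldsymbol z;\boldsymbol a,\boldsymbol c)\,F^{n+r,n+s}(\boldsymbol x,\boldsymbol w;\boldsymbol b,\boldsymbol d). $$ Here $(x_i,x_j,\boldsymbol z)$ denotes $(x_i,x_j,z_1,\dots,z_{p+q})$, and similarly for the other vectors; $(\boldsymbol x,\boldsymbol z)$ denotes concatenation. The matrix inside the Pfaffian is the skew-symmetric matrix with the given $(i,j)$ entries (the entry expression is antisymmetric in $i,j$).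
   Context: Partitions: a partition $\lambda=(\lambda_1\ge\lambda_2\ge\cdots)$ of nonnegative integers with finitely many nonzero parts; $l(\lambda)$ is the number of nonzero parts, $|\lambda|=\sum_i\lambda_i$. In Frobenius notation $\lambda=(\alpha_1,\dots,\alpha_d\,|\,\beta_1,\dots,\beta_d)$ where $d=\#\{i:\lambda_i\ge i\}$, $\alpha_i=\lambda_i-i$, $\beta_i=\lambda'_i-i$ ($\lambda'$ the conjugate partition). For an integer $m\ge 0$, $\mathcal{P}_m$ is the set of partitions $\lambda$ with $l(\lambda)\le m$ of the form $(\alpha_1,\dots,\alpha_d\,|\,\alpha_1+1,\dots,\alpha_d+1)$ (the empty partition included; $|\lambda|$ is then even). For nonnegative integers $p,q$, vectors $\boldsymbol{x}=(x_1,\dots,x_{p+q})$, $\boldsymbol{a}=(a_1,\dots,a_{p+q})$, and partitions $\lambda,\mu$ with $l(\lambda)\le p$, $l(\mu)\le q$, let $V^{p,q}_{\lambda,\mu}(\boldsymbol{x};\boldsymbol{a})$ be the $(p+q)\times(p+q)$ matrix whose $i$-th row is $$(x_i^{\lambda_p},x_i^{\lambda_{p-1}+1},\dots,x_i^{\lambda_1+p-1},\ a_ix_i^{\mu_q},a_ix_i^{\mu_{q-1}+1},\dots,a_ix_i^{\mu_1+q-1}).$$ Define $$F^{p,q}(\boldsymbol{x};\boldsymbol{a})=\sum_{\lambda\in\mathcal{P}_p,\ \mu\in\mathcal{P}_q}(-1)^{(|\lambda|+|\mu|)/2}\det V^{p,q}_{\lambda,\mu}(\boldsymbol{x};\boldsymbol{a}),$$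 with the convention that $F^{0,0}=1$ (determinant of the empty matrix). *)

theory Defs
  imports "Jordan_Normal_Form.Determinant" "HOL-Combinatorics.Permutations"
begin

text \<open>Partitions are represented 0-indexed: lam i is the part lambda_(i+1).\<close>

definition is_partition :: "(nat \<Rightarrow> nat) \<Rightarrow> bool" where
  "is_partition lam \<longleftrightarrow> (\<forall>i. lam (Suc i) \<le> lam i) \<and> finite {i. lam i \<noteq> 0}"

definition part_length :: "(nat \<Rightarrow> nat) \<Rightarrow> nat" where
  "part_length lam = card {i. lam i \<noteq> 0}"

definition part_size :: "(nat \<Rightarrow> nat) \<Rightarrow> nat" where
  "part_size lam = (\<Sum>i<part_length lam. lam i)"

definition conj_part :: "(nat \<Rightarrow> nat) \<Rightarrow> nat \<Rightarrow> nat" where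
  "conj_part lam j = card {i. Suc j \<le> lam i}"

definition durfee :: "(nat \<Rightarrow> nat) \<Rightarrow> nat" where
  "durfee lam = card {i. Suc i \<le> lam i}"

text \<open>Frobenius coordinates (1-indexed k = i+1): alpha_k = lambda_k - k, beta_k = lambda'_k - k.\<close>
definition frob_alpha :: "(nat \<Rightarrow> nat) \<Rightarrow> nat \<Rightarrow> int" where
  "frob_alpha lam i = int (lam i) - int (Suc i)"

definition frob_beta :: "(nat \<Rightarrow> nat) \<Rightarrow> nat \<Rightarrow> int" where
  "frob_beta lam i = int (conj_part lam i) - int (Suc i)"

definition Pset :: "nat \<Rightarrow> (nat \<Rightarrow> nat) set" where
  "Pset m = {lam. is_partition lam \<and> part_length lam \<le> m \<and>
      (\<forall>i < durfee lam. frob_beta lam i = frob_alpha lam i + 1)}"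

definition Vmat :: "nat \<Rightarrow> nat \<Rightarrow> (nat \<Rightarrow> nat) \<Rightarrow> (nat \<Rightarrow> nat) \<Rightarrow> (nat \<Rightarrow> 'a::comm_ring_1)
     \<Rightarrow> (nat \<Rightarrow> 'a) \<Rightarrow> 'a mat" where
  "Vmat p q lam mu x a = mat (p + q) (p + q) (\<lambda>(i, j).
      if j < p then x i ^ (lam (p - 1 - j) + j)
      else a i * x i ^ (mu (q - 1 - (j - p)) + (j - p)))"

definition Ffun :: "nat \<Rightarrow> nat \<Rightarrow> (nat \<Rightarrow> 'a::comm_ring_1) \<Rightarrow> (nat \<Rightarrow> 'a) \<Rightarrow> 'a" where
  "Ffun p q x a = (\<Sum>lam\<in>Pset p. \<Sum>mu\<in>Pset q.
      (-1) ^ ((part_size lam + part_size mu) div 2) * det (Vmat p q lam mu x a))"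

definition pfaffian :: "nat \<Rightarrow> (nat \<Rightarrow> nat \<Rightarrow> 'a::field_char_0) \<Rightarrow> 'a" where
  "pfaffian n A = (\<Sum>\<sigma> | \<sigma> permutes {..<2*n}.
      of_int (sign \<sigma>) * (\<Prod>i<n. A (\<sigma> (2*i)) (\<sigma> (2*i+1)))) / (2 ^ n * fact n)"

definition vconcat :: "nat \<Rightarrow> (nat \<Rightarrow> 'a) \<Rightarrow> (nat \<Rightarrow> 'a) \<Rightarrow> nat \<Rightarrow> 'a" where
  "vconcat m u v k = (if k < m then u k else v (k - m))"

definition vcons2 :: "'a \<Rightarrow> 'a \<Rightarrow> (nat \<Rightarrow> 'a) \<Rightarrow> nat \<Rightarrow> 'a" where
  "vcons2 y1 y2 v k = (if k = 0 then y1 else if k = 1 then y2 else v (k - 2))"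

end

theory Submission
  imports Defs
begin

text \<open>Littlewood's expansion in determinantal form: \<open>F\<^sup>p\<^sup>,\<^sup>q(x;a)\<close> is the determinant with rows
  \<open>(x ^ j * (1 + x\<^sup>2) ^ (p - 1 - j), a * x ^ j * (1 + x\<^sup>2) ^ (q - 1 - j))\<close>, that is, a
  Vandermonde-like determinant in the homogeneous coordinates \<open>u = 1 + x\<^sup>2\<close>, \<open>v = x\<close>, for which
  \<open>u\<^sub>i * v\<^sub>j - u\<^sub>j * v\<^sub>i = (x\<^sub>j - x\<^sub>i) * (1 - x\<^sub>i * x\<^sub>j)\<close>.

  For generic \<open>z\<close> and \<open>w\<close>, column operations using two polynomial combinations that vanish on the
  \<open>z\<close>-rows (respectively \<open>w\<close>-rows) reduce the theorem to \<open>p = q = r = s = 0\<close> with arbitrary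
  weights. That case is proved by induction on n: expand the Pfaffian along its first row and
  compare both sides as binary forms in the homogeneous coordinates of \<open>x\<^sub>1\<close>. Arbitrary \<open>z\<close>, \<open>w\<close>
  follow by moving them along a line to a generic position, as both sides are polynomial in the
  line parameter.\<close>

subsection \<open>Determinants\<close>

text \<open>Why homogeneous coordinates: the induction must let the point x_1 move while its weights
  stay fixed, and it has only the 2n - 1 other points at which to compare. With u and v independent,
  a product of two determinants is a form of degree 2n - 2, exactly the degree that 2n - 1 pairwise
  nonproportional points determine. In x alone the degree would double, and further points such as
  1/x_i would be required. Nonproportionality of (1 + x_i^2, x_i) and (1 + x_j^2, x_j) amounts to
  x_i and x_j being distinct with product different from 1.

  Why arbitrary weights: the reduction replaces the pair (1, a_i) by two values depending on both
  x_i and a_i, so no special shape of the weights survives.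

  Why generic z: the column combinations come from linear systems whose determinant is the product
  of the z_i times F^{p,q}(z;c).\<close>

definition fdet :: "nat \<Rightarrow> (nat \<Rightarrow> nat \<Rightarrow> 'a::comm_ring_1) \<Rightarrow> 'a" where
  "fdet n F = det (mat n n (\<lambda>(i, j). F i j))"

lemma fdet_rows: "fdet n F = (\<Sum>\<sigma> | \<sigma> permutes {0..<n}. signof \<sigma> * (\<Prod>i<n. F i (\<sigma> i)))"
proof -
  have "(\<Prod>i = 0..<n. mat n n (\<lambda>(i, j). F i j) $$ (i, \<sigma> i)) = (\<Prod>i<n. F i (\<sigma> i))"
    if "\<sigma> permutes {0..<n}" for \<sigma>
  proof (rule prod.cong)
    fix i assume "i \<in> {..<n}"
    then show "mat n n (\<lambda>(i, j). F i j) $$ (i, \<sigma> i) = F i (\<sigma> i)"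
      using permutes_in_image[OF that, of i] by simp
  qed auto
  then show ?thesis
    unfolding fdet_def by (subst det_def'[of _ n]) (auto intro!: sum.cong)
qed

lemma fdet_cols: "fdet n F = (\<Sum>\<sigma> | \<sigma> permutes {0..<n}. signof \<sigma> * (\<Prod>j<n. F (\<sigma> j) j))"
proof -
  have "(\<Prod>j<n. mat n n (\<lambda>(i, j). F i j) $$ (\<sigma> j, j)) = (\<Prod>j<n. F (\<sigma> j) j)"
    if "\<sigma> permutes {0..<n}" for \<sigma>
    using permutes_in_image[OF that] by (intro prod.cong) auto
  then show ?thesis
    unfolding fdet_def by (subst det_col[of _ n]) (auto intro!: sum.cong)
qed

lemma fdet_cong:
  assumes "\<And>i j. i < n \<Longrightarrow> j < n \<Longrightarrow> F i j = G i j"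
  shows "fdet n F = fdet n G"
  unfolding fdet_def using assms by (intro arg_cong[of _ _ det] eq_matI) auto

lemma fdet_0 [simp]: "fdet 0 F = 1"
  by (simp add: fdet_def)

lemma fdet_scale_rows: "fdet n (\<lambda>i j. c i * F i j) = (\<Prod>i<n. c i) * fdet n F"
  by (simp add: fdet_rows prod.distrib sum_distrib_left mult_ac)

lemma fdet_add_col:
  assumes "k < n"
  shows "fdet n (\<lambda>i j. if j = k then A i + B i else F i j)
    = fdet n (\<lambda>i j. if j = k then A i else F i j) + fdet n (\<lambda>i j. if j = k then B i else F i j)"
proof -
  have split: "(\<Prod>j<n. (if j = k then C (\<sigma> j) else F (\<sigma> j) j))
      = C (\<sigma> k) * (\<Prod>j\<in>{..<n} - {k}. F (\<sigma> j) j)" for C and \<sigma> :: "nat \<Rightarrow> nat"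
    using assms by (subst prod.remove[of _ k]) (auto intro!: prod.cong)
  show ?thesis
    unfolding fdet_cols sum.distrib[symmetric] 
    by (rule sum.cong) (simp_all only: split split[of "\<lambda>i. A i + B i"] distrib_left distrib_right)
qed

lemma fdet_permute_rows:
  assumes "\<pi> permutes {0..<n}"
  shows "fdet n (\<lambda>i j. F (\<pi> i) j) = signof \<pi> * fdet n F"
proof -
  have "mat n n (\<lambda>(i, j). F (\<pi> i) j) = mat n n (\<lambda>(i, j). mat n n (\<lambda>(i, j). F i j) $$ (\<pi> i, j))"
    using permutes_in_image[OF assms] by (intro eq_matI) auto
  then show ?thesis
    unfolding fdet_def using det_permute_rows[OF mat_carrier assms] by simp
qed

lemma fdet_transpose: "fdet n (\<lambda>i j. F j i) = fdet n F"
  by (simp add: fdet_rows[of n "\<lambda>i j. F j i"] fdet_cols[of n F])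

lemma fdet_permute_cols:
  assumes "\<pi> permutes {0..<n}"
  shows "fdet n (\<lambda>i j. F i (\<pi> j)) = signof \<pi> * fdet n F"
  using fdet_permute_rows[OF assms, of "\<lambda>i j. F j i"] fdet_transpose[of n F]
    fdet_transpose[of n "\<lambda>i j. F i (\<pi> j)"] by simp

lemma fdet_swap_initial_col_blocks:
  assumes "k + n \<le> m"
  shows "fdet m F = (-1) ^ (k * n)
    * fdet m (\<lambda>i j. F i (if j < n then j + k else if j < k + n then j - n else j))"
  unfolding fdet_def
  by (subst det_swap_initial_cols[OF mat_carrier assms], rule arg_cong[of _ _ "\<lambda>A. _ * det A"])
    (rule eq_matI, use assms in auto)

text \<open>Two exchanges of initial blocks: the n columns are carried in front of all l + k
  preceding ones, then the l columns are put back before them. The two signs (-1)^(l n)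
  cancel.\<close>

lemma fdet_swap_col_blocks:
  assumes "l + k + n \<le> m"
  shows "fdet m F = (-1) ^ (k * n) * fdet m (\<lambda>i j. F i
    (if j < l then j else if j < l + n then j + k else if j < l + n + k then j - n else j))"
proof -
  have "fdet m F = (-1) ^ ((l + k) * n) * fdet m (\<lambda>i j. F i
      (if j < n then j + (l + k) else if j < (l + k) + n then j - n else j))"
    using assms by (intro fdet_swap_initial_col_blocks) simp
  also have "fdet m (\<lambda>i j. F i (if j < n then j + (l + k) else if j < (l + k) + n then j - n else j))
      = (-1) ^ (n * l) * fdet m (\<lambda>i j. F i
    (if j < l then j else if j < l + n then j + k else if j < l + n + k then j - n else j))"
    by (subst fdet_swap_initial_col_blocks[of n l])
      (use assms in \<open>auto intro!: arg_cong2[of _ _ _ _ "(*)"] fdet_cong arg_cong[of _ _ "F _"]\<close>)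
  finally show ?thesis
    by (simp add: power_add[symmetric] mult.assoc[symmetric] algebra_simps)
      (simp add: power_add mult.assoc[symmetric] flip: power_mult_distrib)
qed

lemma fdet_block_upper_right_zero:
  fixes F :: "nat \<Rightarrow> nat \<Rightarrow> 'a::idom"
  assumes "\<And>i j. i < m \<Longrightarrow> j < k \<Longrightarrow> F i (m + j) = 0"
  shows "fdet (m + k) F = fdet m F * fdet k (\<lambda>i j. F (m + i) (m + j))"
proof -
  have "mat (m + k) (m + k) (\<lambda>(i, j). F i j) = four_block_mat (mat m m (\<lambda>(i, j). F i j)) (0\<^sub>m m k)
      (mat k m (\<lambda>(i, j). F (m + i) j)) (mat k k (\<lambda>(i, j). F (m + i) (m + j)))"
    using assms by (intro eq_matI) (auto, metis add_diff_inverse_nat add_less_cancel_left)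
  then show ?thesis
    unfolding fdet_def by (simp add: det_four_block_mat_upper_right_zero[of _ m _ k])
qed

lemma fdet_block_lower_left_zero:
  fixes F :: "nat \<Rightarrow> nat \<Rightarrow> 'a::idom"
  assumes "\<And>i j. i < k \<Longrightarrow> j < m \<Longrightarrow> F (m + i) j = 0"
  shows "fdet (m + k) F = fdet m F * fdet k (\<lambda>i j. F (m + i) (m + j))"
  using fdet_block_upper_right_zero[of m k "\<lambda>i j. F j i"] assms
  by (simp only: fdet_transpose[of _ F] fdet_transpose[of k "\<lambda>i j. F (m + i) (m + j)"])

text \<open>A permutation contributing to the Leibniz sum cannot decrease \<rho> anywhere, and since it
  preserves the total of \<rho>, it must be the identity.\<close>

lemma fdet_unitriangular:
  fixes \<rho> :: "nat \<Rightarrow> nat"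
  assumes diag: "\<And>i. i < n \<Longrightarrow> F i i = 1"
    and tri: "\<And>i j. i < n \<Longrightarrow> j < n \<Longrightarrow> i \<noteq> j \<Longrightarrow> \<rho> j \<le> \<rho> i \<Longrightarrow> F i j = 0"
  shows "fdet n F = 1"
proof -
  have zero: "signof \<sigma> * (\<Prod>i<n. F i (\<sigma> i)) = 0" if \<sigma>: "\<sigma> permutes {0..<n}" "\<sigma> \<noteq> id" for \<sigma>
  proof (rule ccontr)
    assume nz: "signof \<sigma> * (\<Prod>i<n. F i (\<sigma> i)) \<noteq> 0"
    have lt: "\<sigma> i < n" if "i < n" for i
      using permutes_in_image[OF \<sigma>(1)] that by auto
    have ge: "\<rho> i < \<rho> (\<sigma> i)" if "i < n" "\<sigma> i \<noteq> i" for i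
    proof (rule ccontr)
      assume "\<not> \<rho> i < \<rho> (\<sigma> i)"
      then have "F i (\<sigma> i) = 0" using tri[of i "\<sigma> i"] lt that by auto
      then have "(\<Prod>i<n. F i (\<sigma> i)) = 0"
        using that by (subst prod.remove[of _ i]) auto
      then show False using nz by simp
    qed
    obtain k where k: "\<sigma> k \<noteq> k" using \<sigma>(2) by fastforce
    then have "k < n" using \<sigma>(1) unfolding permutes_def by force
    then have "(\<Sum>i\<in>{0..<n}. \<rho> i) < (\<Sum>i\<in>{0..<n}. \<rho> (\<sigma> i))"
      using ge k by (intro sum_strict_mono_ex1) (auto intro!: bexI[of _ k], metis less_imp_le order_refl)
    moreover have "(\<Sum>i\<in>{0..<n}. \<rho> (\<sigma> i)) = (\<Sum>i\<in>{0..<n}. \<rho> i)"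
      using sum.permute[OF \<sigma>(1), of \<rho>] by (simp add: o_def)
    ultimately show False by simp
  qed
  have "fdet n F = signof id * (\<Prod>i<n. F i (id i))"
    unfolding fdet_rows
    by (subst sum.remove[of _ id])
      (auto simp: permutes_id finite_permutations zero intro!: sum.neutral)
  then show ?thesis using diag by simp
qed

lemma fdet_mult: "fdet n F * fdet n G = fdet n (\<lambda>i j. \<Sum>k<n. F i k * G k j)"
proof -
  have "mat n n (\<lambda>(i, j). F i j) * mat n n (\<lambda>(i, j). G i j)
      = mat n n (\<lambda>(i, j). \<Sum>k<n. F i k * G k j)"
    by (intro eq_matI) (auto simp: scalar_prod_def lessThan_atLeast0 intro!: sum.cong)
  then show ?thesis
    unfolding fdet_def by (metis det_mult mat_carrier)
qed

text \<open>All operations are made at once, as right multiplication by the identity plus E. The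
  rank \<rho> certifies that no cycle occurs: a column receives multiples only of columns of
  strictly smaller rank.\<close>

lemma fdet_col_operations:
  fixes \<rho> :: "nat \<Rightarrow> nat"
  assumes tri: "\<And>k j. k < n \<Longrightarrow> j < n \<Longrightarrow> \<rho> j \<le> \<rho> k \<Longrightarrow> E k j = 0"
  shows "fdet n (\<lambda>i j. F i j + (\<Sum>k<n. F i k * E k j)) = fdet n F"
proof -
  have "fdet n F = fdet n F * fdet n (\<lambda>k j. of_bool (k = j) + E k j)"
    using fdet_unitriangular[of n "\<lambda>k j. of_bool (k = j) + E k j" \<rho>] tri by simp
  also have "\<dots> = fdet n (\<lambda>i j. F i j + (\<Sum>k<n. F i k * E k j))"
    unfolding fdet_mult
    by (rule fdet_cong) (simp add: algebra_simps sum.distrib of_bool_def if_distrib[of "(*) _"] cong: if_cong)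
  finally show ?thesis ..
qed

lemma fdet_nonzero_solve:
  fixes F :: "nat \<Rightarrow> nat \<Rightarrow> 'a::field"
  assumes "fdet n F \<noteq> 0"
  obtains y where "\<And>i. i < n \<Longrightarrow> (\<Sum>j<n. F i j * y j) = b i"
proof -
  define A where "A = mat n n (\<lambda>(i, j). F i j)"
  have A: "A \<in> carrier_mat n n" by (simp add: A_def)
  define w where "w = (1 / det A) \<cdot>\<^sub>v (adj_mat A *\<^sub>v vec n b)"
  have [simp]: "adj_mat A *\<^sub>v vec n b \<in> carrier_vec n"
    using adj_mat(1)[OF A] by auto
  have w: "w \<in> carrier_vec n" by (simp add: w_def)
  have "A *\<^sub>v w = (1 / det A) \<cdot>\<^sub>v ((A * adj_mat A) *\<^sub>v vec n b)"
    unfolding w_def using adj_mat(1)[OF A] A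
    by (simp add: mult_mat_vec[OF A] assoc_mult_mat_vec[of _ n n _ n])
  also have "\<dots> = vec n b"
    using assms unfolding adj_mat(2)[OF A] by (auto simp: fdet_def A_def intro!: eq_vecI)
  finally have "A *\<^sub>v w = vec n b" .
  have "(\<Sum>j<n. F i j * w $ j) = b i" if "i < n" for i
    using arg_cong[OF \<open>A *\<^sub>v w = vec n b\<close>, of "\<lambda>v. v $ i"] that w
    by (simp add: A_def scalar_prod_def lessThan_atLeast0)
  then show ?thesis by (rule that)
qed

lemma fdet_zero_kernel:
  fixes F :: "nat \<Rightarrow> nat \<Rightarrow> 'a::field"
  assumes "fdet n F = 0"
  obtains y j where "j < n" "y j \<noteq> 0" "\<And>i. i < n \<Longrightarrow> (\<Sum>j<n. F i j * y j) = 0"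
proof -
  define A where "A = mat n n (\<lambda>(i, j). F i j)"
  have A: "A \<in> carrier_mat n n" by (simp add: A_def)
  obtain w where w: "w \<in> carrier_vec n" "w \<noteq> 0\<^sub>v n" "A *\<^sub>v w = 0\<^sub>v n"
    using assms det_0_iff_vec_prod_zero_field[OF A] by (auto simp: fdet_def A_def)
  obtain j where "j < n" "w $ j \<noteq> 0" using w(1,2) by (metis carrier_vecD eq_vecI index_zero_vec)
  moreover have "(\<Sum>j<n. F i j * w $ j) = 0" if "i < n" for i
    using arg_cong[OF w(3), of "\<lambda>v. v $ i"] that w(1)
    by (simp add: A_def scalar_prod_def lessThan_atLeast0)
  ultimately show ?thesis using that by blast
qed

subsection \<open>The partitions \<open>(\<alpha> | \<alpha> + 1)\<close>\<close>

text \<open>The length, the Durfee size and the conjugate parts are all defined as cardinalities of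
  down-closed sets; this turns comparisons with them into inequalities between parts.\<close>

lemma mem_downset_iff_less_card:
  fixes S :: "nat set"
  assumes "finite S" "\<And>i j. i \<le> j \<Longrightarrow> j \<in> S \<Longrightarrow> i \<in> S"
  shows "i \<in> S \<longleftrightarrow> i < card S"
proof -
  have "S = {..<card S}"
  proof (cases "S = {}")
    case False
    then have "S = {..Max S}"
      using assms(1) assms(2)[OF _ Max_in[OF assms(1)]] by (auto intro: Max_ge)
    then show ?thesis
      by (metis card_atMost lessThan_Suc_atMost)
  qed simp
  then show ?thesis by (metis lessThan_iff)
qed

lemma is_partition_antimono:
  assumes "is_partition lam" "i \<le> j"
  shows "lam j \<le> lam i"
  using assms(2,1) by (induction rule: dec_induct) (auto simp: is_partition_def intro: order_trans)

lemma
  assumes "is_partition lam"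
  shows less_conj_part_iff: "k < conj_part lam i \<longleftrightarrow> i < lam k"
    and less_durfee_iff: "i < durfee lam \<longleftrightarrow> i < lam i"
    and less_part_length_iff: "i < part_length lam \<longleftrightarrow> lam i \<noteq> 0"
proof -
  note anti = is_partition_antimono[OF assms]
  have fin: "finite {i. lam i \<noteq> 0}" using assms by (simp add: is_partition_def)
  have "k \<in> {k. Suc i \<le> lam k} \<longleftrightarrow> k < card {k. Suc i \<le> lam k}"
  proof (rule mem_downset_iff_less_card)
    show "a \<in> {k. Suc i \<le> lam k}" if "a \<le> b" "b \<in> {k. Suc i \<le> lam k}" for a b
      using that anti[of a b] by simp
  qed (rule finite_subset[OF _ fin], auto)
  then show "k < conj_part lam i \<longleftrightarrow> i < lam k"
    by (simp add: conj_part_def Suc_le_eq)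
  have "i \<in> {k. Suc k \<le> lam k} \<longleftrightarrow> i < card {k. Suc k \<le> lam k}"
  proof (rule mem_downset_iff_less_card)
    show "a \<in> {k. Suc k \<le> lam k}" if "a \<le> b" "b \<in> {k. Suc k \<le> lam k}" for a b
      using that anti[of a b] by simp
  qed (rule finite_subset[OF _ fin], auto)
  then show "i < durfee lam \<longleftrightarrow> i < lam i"
    by (simp add: durfee_def Suc_le_eq)
  have "i \<in> {k. lam k \<noteq> 0} \<longleftrightarrow> i < card {k. lam k \<noteq> 0}"
  proof (rule mem_downset_iff_less_card)
    show "a \<in> {k. lam k \<noteq> 0}" if "a \<le> b" "b \<in> {k. lam k \<noteq> 0}" for a b
      using that anti[of a b] by simp
  qed (rule fin)
  then show "i < part_length lam \<longleftrightarrow> lam i \<noteq> 0"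
    by (simp add: part_length_def)
qed

text \<open>On the diagonal, \<beta> = \<alpha> + 1 means that column i is one cell longer than row
  i. Expressed through membership, row k reaches beyond i exactly for k up to \<open>lam i\<close>;
  this removes all cardinalities from the recursion below.\<close>

lemma Pset_iff:
  "lam \<in> Pset m \<longleftrightarrow> (\<forall>i. lam (Suc i) \<le> lam i) \<and> (\<forall>i\<ge>m. lam i = 0)
    \<and> (\<forall>i k. i < lam i \<longrightarrow> (i < lam k \<longleftrightarrow> k \<le> lam i))"
proof (cases "is_partition lam")
  case True
  have frob: "frob_beta lam i = frob_alpha lam i + 1 \<longleftrightarrow> (\<forall>k. i < lam k \<longleftrightarrow> k \<le> lam i)" for i
  proof -
    have "frob_beta lam i = frob_alpha lam i + 1 \<longleftrightarrow> conj_part lam i = Suc (lam i)"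
      by (auto simp: frob_beta_def frob_alpha_def)
    also have "\<dots> \<longleftrightarrow> (\<forall>k. k < conj_part lam i \<longleftrightarrow> k < Suc (lam i))"
      by (metis linorder_neqE_nat less_irrefl)
    finally show ?thesis by (simp add: less_conj_part_iff[OF True] less_Suc_eq_le)
  qed
  have "part_length lam \<le> m \<longleftrightarrow> (\<forall>i\<ge>m. lam i = 0)"
    using less_part_length_iff[OF True] by (meson leD leI less_le_trans not_less_iff_gr_or_eq order_refl)
  then show ?thesis
    using True by (auto simp: Pset_def frob less_durfee_iff is_partition_def)
next
  case False
  moreover have "finite {i. lam i \<noteq> 0}" if "\<forall>i\<ge>m. lam i = 0"
    by (rule finite_subset[of _ "{..<m}"]) (use that in \<open>auto intro: leI ccontr\<close>)
  ultimately show ?thesis by (auto simp: Pset_def is_partition_def)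
qed

lemma Pset_frobenius: "lam \<in> Pset m \<Longrightarrow> i < lam i \<Longrightarrow> i < lam k \<longleftrightarrow> k \<le> lam i"
  by (simp add: Pset_iff)

lemma Pset_0: "Pset 0 = {\<lambda>_. 0}"
  by (auto simp: Pset_iff)

text \<open>A first row of length a > 0 would force a first column of length a + 1 > 1. The case is
  the base of the recursion, since \<open>hook_ext 0\<close> yields only the empty
  partition.\<close>

lemma Pset_1: "Pset (Suc 0) = {\<lambda>_. 0}"
proof -
  have "lam = (\<lambda>_. 0)" if "lam \<in> Pset (Suc 0)" for lam
  proof -
    have "lam i = 0" if "i > 0" for i using \<open>lam \<in> _\<close> that by (auto simp: Pset_iff)
    moreover have "lam 0 = 0"
    proof (rule ccontr)
      assume "lam 0 \<noteq> 0"
      then have "0 < lam (lam 0)" using Pset_frobenius[OF that, of 0 "lam 0"] by simp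
      then show False using calculation[of "lam 0"] \<open>lam 0 \<noteq> 0\<close> by simp
    qed
    ultimately show ?thesis by (metis neq0_conv)
  qed
  then show ?thesis by (auto simp: Pset_iff)
qed

text \<open>In Frobenius notation, \<open>hook_ext p\<close> prepends the coordinates \<open>(p - 1 | p)\<close>.\<close>

definition hook_ext :: "nat \<Rightarrow> (nat \<Rightarrow> nat) \<Rightarrow> nat \<Rightarrow> nat" where
  "hook_ext p lam i = (if i = 0 then p else if i \<le> p then Suc (lam (i - 1)) else 0)"

text \<open>The first column has at most p cells and, if the partition is nonempty, exceeds the
  first row by one. This bound keeps \<open>hook_ext p lam\<close> weakly decreasing.\<close>

lemma Pset_first_part_less:
  assumes "lam \<in> Pset p" "p > 0"
  shows "lam i < p"
proof -
  have "lam 0 < p"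
  proof (rule ccontr)
    assume "\<not> lam 0 < p"
    moreover have "lam p = 0" using assms(1) by (simp add: Pset_iff)
    ultimately show False using assms Pset_frobenius[of lam p 0 p] by simp
  qed
  moreover have "lam i \<le> lam 0"
    using assms(1) by (induction i) (auto simp: Pset_iff intro: order_trans)
  ultimately show ?thesis by simp
qed

lemma hook_ext_in_Pset:
  assumes "lam \<in> Pset p" "p > 0"
  shows "hook_ext p lam \<in> Pset (Suc p)"
proof -
  have lt: "lam i < p" for i using Pset_first_part_less assms by blast
  have lam: "lam (Suc i) \<le> lam i" "i \<ge> p \<Longrightarrow> lam i = 0"
    "i < lam i \<Longrightarrow> i < lam k \<longleftrightarrow> k \<le> lam i" for i k
    using assms(1) by (auto simp: Pset_iff)
  have "hook_ext p lam (Suc i) \<le> hook_ext p lam i" for i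
    using lam(1)[of "i - 1"] lt[of i] by (cases i) (auto simp: hook_ext_def Suc_le_eq)
  moreover have "i < hook_ext p lam k \<longleftrightarrow> k \<le> hook_ext p lam i" if "i < hook_ext p lam i" for i k
  proof (cases i)
    case 0
    then show ?thesis using assms(2) by (auto simp: hook_ext_def)
  next
    case (Suc i')
    then have i': "i' < lam i'" "i' < p" using that by (auto simp: hook_ext_def split: if_splits)
    show ?thesis
      using lam(3)[OF i'(1), of "k - 1"] lt[of i'] i' Suc
      by (cases k) (auto simp: hook_ext_def)
  qed
  ultimately show ?thesis by (auto simp: Pset_iff hook_ext_def)
qed

text \<open>Either row p is empty, or the first column has the full length p + 1. In the latter case
  the first row has length p, and removing the outer hook leaves a partition of the same
  kind.\<close>

lemma Pset_Suc:
  assumes "p > 0"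
  shows "Pset (Suc p) = Pset p \<union> hook_ext p ` Pset p"
proof -
  have "lam \<in> Pset p \<union> hook_ext p ` Pset p" if "lam \<in> Pset (Suc p)" for lam
  proof (cases "lam p = 0")
    case True
    then have "lam i = 0" if "i \<ge> p" for i
      using that \<open>lam \<in> _\<close> by (cases "i = p") (auto simp: Pset_iff)
    then show ?thesis using that by (auto simp: Pset_iff)
  next
    case False
    have lam: "lam (Suc i) \<le> lam i" "i \<ge> Suc p \<Longrightarrow> lam i = 0"
      "i < lam i \<Longrightarrow> i < lam k \<longleftrightarrow> k \<le> lam i" for i k
      using that by (auto simp: Pset_iff)
    have anti: "lam j \<le> lam i" if "i \<le> j" for i j
      using that by (induction rule: dec_induct) (auto intro: order_trans lam(1))
    have "0 < lam 0" using False anti[of 0 p] by simp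
    then have "lam 0 = p" using lam(3)[of 0 p] lam(3)[of 0 "Suc p"] lam(2)[of "Suc p"] False by auto
    have pos: "0 < lam i" if "i \<le> p" for i using anti[OF that] False by linarith
    define mu where "mu = (\<lambda>i. lam (Suc i) - 1)"
    have "hook_ext p mu = lam"
      using pos lam(2) \<open>lam 0 = p\<close>
      by (intro ext) (auto simp: hook_ext_def mu_def Suc_diff_le gr0_conv_Suc)
    moreover have "mu (Suc i) \<le> mu i" for i
      using lam(1)[of "Suc i"] by (simp add: mu_def)
    moreover have "mu i = 0" if "i \<ge> p" for i using that lam(2)[of "Suc i"] by (simp add: mu_def)
    moreover have "i < mu k \<longleftrightarrow> k \<le> mu i" if "i < mu i" for i k
      using lam(3)[of "Suc i" "Suc k"] that unfolding mu_def by arith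
    ultimately have "mu \<in> Pset p" "hook_ext p mu = lam" by (auto simp: Pset_iff)
    then show ?thesis by auto
  qed
  moreover have "Pset p \<subseteq> Pset (Suc p)" by (auto simp: Pset_iff)
  ultimately show ?thesis using hook_ext_in_Pset assms by auto
qed

lemma inj_on_hook_ext: "inj_on (hook_ext p) (Pset p)"
proof (rule inj_onI, rule ext)
  fix lam mu i assume *: "lam \<in> Pset p" "mu \<in> Pset p" "hook_ext p lam = hook_ext p mu"
  show "lam i = mu i"
    using *(1,2) fun_cong[OF *(3), of "Suc i"] by (cases "i < p") (simp_all add: hook_ext_def Pset_iff)
qed

lemma hook_ext_notin_Pset: "p > 0 \<Longrightarrow> hook_ext p lam \<notin> Pset p"
  by (auto simp: Pset_iff hook_ext_def)

lemma finite_Pset: "finite (Pset p)"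
proof (induction p)
  case (Suc p)
  then show ?case by (cases "p = 0") (auto simp: Pset_1 Pset_Suc)
qed (simp add: Pset_0)

lemma part_size_eq:
  assumes "lam \<in> Pset m"
  shows "part_size lam = (\<Sum>i<m. lam i)"
proof -
  have "is_partition lam" "part_length lam \<le> m" using assms by (auto simp: Pset_def)
  then show ?thesis
    unfolding part_size_def
    by (intro sum.mono_neutral_left) (auto simp: not_less[symmetric] less_part_length_iff)
qed

text \<open>The added hook has p cells in its row and p more in its column. The sign of the
  partition therefore changes by (-1)^p, which will cancel the cost of moving one column past p
  others.\<close>

lemma part_size_hook_ext:
  assumes "lam \<in> Pset p" "p > 0"
  shows "part_size (hook_ext p lam) = part_size lam + 2 * p"
proof -
  have "part_size (hook_ext p lam) = (\<Sum>i<Suc p. hook_ext p lam i)"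
    using assms by (intro part_size_eq hook_ext_in_Pset)
  also have "\<dots> = p + (\<Sum>i<p. Suc (lam i))"
    by (subst sum.lessThan_Suc_shift) (auto simp: hook_ext_def intro!: sum.cong)
  also have "(\<Sum>i<p. Suc (lam i)) = (\<Sum>i<p. lam i) + p"
    by (simp only: Suc_eq_plus1 sum.distrib) simp
  finally show ?thesis by (simp add: part_size_eq[OF assms(1)])
qed

lemma even_part_size: "lam \<in> Pset p \<Longrightarrow> even (part_size lam)"
proof (induction p arbitrary: lam)
  case (Suc p)
  then show ?case
  proof (cases "p = 0")
    case False
    then show ?thesis using Suc by (auto simp: Pset_Suc part_size_hook_ext)
  qed (auto simp: Pset_1 part_size_def)
qed (simp add: Pset_0 part_size_def)

lemma sum_Pset_Suc:
  assumes "p > 0"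
  shows "(\<Sum>lam\<in>Pset (Suc p). f lam) = (\<Sum>lam\<in>Pset p. f lam + f (hook_ext p lam))"
proof -
  have "(\<Sum>lam\<in>Pset (Suc p). f lam) = (\<Sum>lam\<in>Pset p. f lam) + (\<Sum>lam\<in>hook_ext p ` Pset p. f lam)"
    unfolding Pset_Suc[OF assms] using hook_ext_notin_Pset[OF assms]
    by (intro sum.union_disjoint) (auto simp: finite_Pset)
  then show ?thesis by (simp add: sum.reindex[OF inj_on_hook_ext] sum.distrib)
qed

subsection \<open>Binary forms\<close>

text \<open>Forms are functions of two scalars, and the degree is a label, not a computed quantity:
  zero is a form of every degree, and closure rules suffice to establish degrees.\<close>

inductive hom2 :: "nat \<Rightarrow> ('a::comm_ring_1 \<Rightarrow> 'a \<Rightarrow> 'a) \<Rightarrow> bool" where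
  monomial: "hom2 (k + l) (\<lambda>U V. c * U ^ k * V ^ l)"
| add: "hom2 m F \<Longrightarrow> hom2 m G \<Longrightarrow> hom2 m (\<lambda>U V. F U V + G U V)"

lemma hom2_const: "hom2 0 (\<lambda>_ _. c)"
  using hom2.monomial[of 0 0 c] by simp

lemma hom2_zero: "hom2 m (\<lambda>_ _. 0)"
  using hom2.monomial[of m 0 0] by simp

lemma hom2_monomial: "m = k + l \<Longrightarrow> hom2 m (\<lambda>U V. c * (V ^ k * U ^ l))"
  using hom2.monomial[of l k c] by (simp add: mult_ac add.commute)

lemma hom2_linear: "hom2 1 (\<lambda>U V. U * a - b * V)"
  using hom2.add[OF hom2.monomial[of 1 0 a, simplified] hom2.monomial[of 0 1 "-b", simplified]]
  by (simp add: mult.commute)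

lemma hom2_mult:
  assumes "hom2 m F" "hom2 m' G"
  shows "hom2 (m + m') (\<lambda>U V. F U V * G U V)"
  using assms
proof (induction arbitrary: G rule: hom2.induct)
  case (monomial k l c)
  from monomial.prems show ?case
  proof (induction rule: hom2.induct)
    case (monomial k' l' c')
    show ?case
      using hom2.monomial[of "k + k'" "l + l'" "c * c'"] by (simp add: power_add mult_ac add_ac)
  next
    case (add m F G)
    then show ?case using hom2.add by (fastforce simp: distrib_left)
  qed
next
  case (add m F G)
  then show ?case using hom2.add by (fastforce simp: distrib_right)
qed

lemma hom2_cmult: "hom2 m F \<Longrightarrow> hom2 m (\<lambda>U V. c * F U V)"
  using hom2_mult[OF hom2_const[of c]] by simp

lemma hom2_sum: "(\<And>i. i \<in> S \<Longrightarrow> hom2 m (F i)) \<Longrightarrow> hom2 m (\<lambda>U V. \<Sum>i\<in>S. F i U V)"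
  by (induction S rule: infinite_finite_induct) (auto intro: hom2_zero hom2.add)

lemma hom2_prod:
  "finite S \<Longrightarrow> (\<And>i. i \<in> S \<Longrightarrow> hom2 (d i) (F i)) \<Longrightarrow> hom2 (sum d S) (\<lambda>U V. \<Prod>i\<in>S. F i U V)"
  by (induction S rule: finite_induct) (auto intro: hom2_const hom2_mult)

text \<open>Each Leibniz term takes exactly one factor from row 0, the only row that depends on U
  and V.\<close>

lemma hom2_fdet:
  assumes "n > 0" "\<And>j. j < n \<Longrightarrow> hom2 m (\<lambda>U V. F U V 0 j)"
    and "\<And>i j. 0 < i \<Longrightarrow> hom2 0 (\<lambda>U V. F U V i j)"
  shows "hom2 m (\<lambda>U V. fdet n (F U V))"
  unfolding fdet_rows
proof (rule hom2_sum, rule hom2_cmult)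
  fix \<sigma> assume "\<sigma> \<in> {\<sigma>. \<sigma> permutes {0..<n}}"
  then have "\<sigma> 0 < n" using permutes_in_image[of \<sigma> "{0..<n}" 0] assms(1) by simp
  then have "hom2 (\<Sum>i<n. if i = 0 then m else 0) (\<lambda>U V. \<Prod>i<n. F U V i (\<sigma> i))"
    using assms by (intro hom2_prod) auto
  then show "hom2 m (\<lambda>U V. \<Prod>i<n. F U V i (\<sigma> i))" using assms(1) by simp
qed

lemma hom2_coefficients:
  "hom2 m F \<Longrightarrow> \<exists>c. \<forall>U V. F U V = (\<Sum>k\<le>m. c k * U ^ k * V ^ (m - k))"
proof (induction rule: hom2.induct)
  case (monomial k l c)
  have "c * U ^ k * V ^ l = (\<Sum>i\<le>k + l. (if i = k then c else 0) * U ^ i * V ^ (k + l - i))" for U V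
    by (subst sum.remove[of _ k]) (auto intro!: sum.neutral)
  then show ?case by (intro exI[of _ "\<lambda>i. if i = k then c else 0"]) blast
next
  case (add m F G)
  then obtain c d where "\<And>U V. F U V = (\<Sum>k\<le>m. c k * U ^ k * V ^ (m - k))"
    "\<And>U V. G U V = (\<Sum>k\<le>m. d k * U ^ k * V ^ (m - k))" by blast
  then show ?case
    by (intro exI[of _ "\<lambda>k. c k + d k"]) (simp add: sum.distrib distrib_right)
qed

text \<open>Dehomogenise by t = a/b. At most one point has b = 0, as two such points would be
  proportional. If there is one, it kills the top coefficient, so the degree drops below m and the
  remaining m roots still suffice.\<close>

lemma hom2_sum_coefficients_zero:
  fixes c :: "nat \<Rightarrow> 'a::field"
  assumes I: "finite I" "card I = Suc m"
    and nonprop: "\<And>i j. i \<in> I \<Longrightarrow> j \<in> I \<Longrightarrow> i \<noteq> j \<Longrightarrow> a i * b j \<noteq> a j * b i"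
    and vanish: "\<And>i. i \<in> I \<Longrightarrow> (\<Sum>k\<le>m. c k * a i ^ k * b i ^ (m - k)) = 0"
  shows "k \<le> m \<Longrightarrow> c k = 0"
proof -
  define P where "P = (\<Sum>k\<le>m. monom (c k) k)"
  have coeff_P: "coeff P k = (if k \<le> m then c k else 0)" for k
    by (simp add: P_def coeff_sum)
  have deg: "degree P \<le> m" by (rule degree_le) (simp add: coeff_P)
  have root: "poly P (a i / b i) = 0" if "i \<in> I" "b i \<noteq> 0" for i
  proof -
    have "b i ^ m * poly P (a i / b i) = (\<Sum>k\<le>m. c k * a i ^ k * b i ^ (m - k))"
      unfolding P_def poly_sum sum_distrib_left
      using that by (intro sum.cong) (auto simp: poly_monom power_divide power_diff field_simps)
    then show ?thesis using vanish[OF that(1)] that(2) by simp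
  qed
  have inj: "inj_on (\<lambda>i. a i / b i) {i \<in> I. b i \<noteq> 0}"
    using nonprop by (auto simp: inj_on_def field_simps)
  have few: "card {i \<in> I. b i \<noteq> 0} \<le> degree P" if "P \<noteq> 0"
  proof -
    have "card {i \<in> I. b i \<noteq> 0} = card ((\<lambda>i. a i / b i) ` {i \<in> I. b i \<noteq> 0})"
      using inj by (simp add: card_image)
    also have "\<dots> \<le> card {t. poly P t = 0}"
      using that root by (intro card_mono poly_roots_finite) auto
    finally show ?thesis using card_poly_roots_bound[OF that] by simp
  qed
  have "P = 0"
  proof (cases "\<exists>i\<in>I. b i = 0")
    case False
    then have "{i \<in> I. b i \<noteq> 0} = I" by auto
    then show ?thesis using few I deg by fastforce
  next
    case True
    then obtain i where i: "i \<in> I" "b i = 0" by auto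
    have rest: "{i \<in> I. b i \<noteq> 0} = I - {i}"
      using nonprop[OF i(1)] i by force
    have "(\<Sum>k\<le>m. c k * a i ^ k * b i ^ (m - k)) = c m * a i ^ m"
      using i(2) by (subst sum.remove[of _ m]) (auto intro!: sum.neutral)
    then have "c m * a i ^ m = 0" using vanish[OF i(1)] by simp
    \<comment> \<open>For m > 0 there is a second point in \<open>I\<close>, and nonproportionality
      with it excludes a_i = b_i = 0.\<close>
    moreover have "a i ^ m \<noteq> 0"
    proof (cases "m = 0")
      case False
      moreover have "card (I - {i}) = m" using I i by simp
      ultimately have "I - {i} \<noteq> {}" by fastforce
      then obtain j where "j \<in> I" "j \<noteq> i" by auto
      then show ?thesis using nonprop[OF i(1), of j] i(2) by auto
    qed simp
    ultimately have "c m = 0" by (metis mult_eq_0_iff)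
    show ?thesis
    proof (rule ccontr)
      assume "P \<noteq> 0"
      then have "m \<le> degree P" using few I i by (simp add: rest)
      then have "degree P = m" using deg by simp
      then have "lead_coeff P = 0" using \<open>c m = 0\<close> by (simp add: coeff_P)
      then show False using \<open>P \<noteq> 0\<close> by simp
    qed
  qed
  then show "c k = 0" if "k \<le> m" using coeff_P[of k] that by simp
qed

lemma hom2_eq:
  fixes F G :: "'a::field \<Rightarrow> 'a \<Rightarrow> 'a"
  assumes "hom2 m F" "hom2 m G" and I: "finite I" "card I = Suc m"
    and nonprop: "\<And>i j. i \<in> I \<Longrightarrow> j \<in> I \<Longrightarrow> i \<noteq> j \<Longrightarrow> a i * b j \<noteq> a j * b i"
    and eq: "\<And>i. i \<in> I \<Longrightarrow> F (a i) (b i) = G (a i) (b i)"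
  shows "F U V = G U V"
proof -
  obtain c where c: "\<And>U V. F U V + - 1 * G U V = (\<Sum>k\<le>m. c k * U ^ k * V ^ (m - k))"
    using hom2_coefficients[OF hom2.add[OF assms(1) hom2_cmult[OF assms(2), of "- 1"]]] by blast
  have "c k = 0" if "k \<le> m" for k
  proof (rule hom2_sum_coefficients_zero[OF I nonprop _ that])
    show "(\<Sum>k\<le>m. c k * a i ^ k * b i ^ (m - k)) = 0" if "i \<in> I" for i
      using c[of "a i" "b i"] eq[OF that] by simp
  qed
  then have "F U V + - 1 * G U V = 0" unfolding c by simp
  then show ?thesis by simp
qed

section \<open>Products over pairs of indices and their sign under transpositions\<close>

definition pairprod :: "nat \<Rightarrow> (nat \<Rightarrow> nat \<Rightarrow> 'a::comm_monoid_mult) \<Rightarrow> 'a" where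
  "pairprod M D = (\<Prod>j<M. \<Prod>i<j. D i j)"

lemma pairprod_Suc_shift:
  "pairprod (Suc M) D = (\<Prod>j<M. D 0 (Suc j)) * pairprod M (\<lambda>i j. D (Suc i) (Suc j))"
  unfolding pairprod_def prod.lessThan_Suc_shift by (simp add: prod.distrib)

lemma pairprod_Suc_Suc_shift:
  "pairprod (Suc (Suc M)) D = D 0 1 * (\<Prod>j<M. D 0 (Suc (Suc j)))
    * ((\<Prod>j<M. D 1 (Suc (Suc j))) * pairprod M (\<lambda>i j. D (Suc (Suc i)) (Suc (Suc j))))"
  unfolding pairprod_Suc_shift prod.lessThan_Suc_shift[of "\<lambda>j. D 0 (Suc j)"] by simp

text \<open>Exchanging 0 and 1 only reverses the factor \<open>D 0 1\<close>. Any other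
  transposition of 0 is conjugated by this one into a transposition fixing 0; splitting off the
  factors with index 0 then leaves a smaller case. Three sign changes occur in all.\<close>

lemma pairprod_swap:
  fixes D :: "nat \<Rightarrow> nat \<Rightarrow> 'a::comm_ring_1"
  assumes "\<And>i j. D j i = - D i j" "m < M"
  shows "pairprod M (\<lambda>i j. D (Transposition.transpose 0 m i) (Transposition.transpose 0 m j))
    = of_int (sign (Transposition.transpose 0 m)) * pairprod M D"
proof -
  let ?sw = "Transposition.transpose :: nat \<Rightarrow> nat \<Rightarrow> nat \<Rightarrow> nat"
  have swap01: "pairprod M (\<lambda>i j. D (?sw 0 1 i) (?sw 0 1 j)) = - pairprod M D"
    if "\<And>i j. D j i = - D i j" "1 < M" for M and D :: "nat \<Rightarrow> nat \<Rightarrow> 'a"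
  proof -
    obtain M' where M: "M = Suc (Suc M')" using \<open>1 < M\<close> by (auto simp: less_iff_Suc_add)
    have sw: "?sw 0 1 0 = 1" "?sw 0 1 1 = 0" "?sw 0 1 (Suc (Suc i)) = Suc (Suc i)" for i
      by (auto simp: Transposition.transpose_def)
    show ?thesis
      unfolding M pairprod_Suc_Suc_shift sw that(1)[of 1 0] by (simp add: mult_ac)
  qed
  have "pairprod M (\<lambda>i j. D (?sw 0 (Suc m) i) (?sw 0 (Suc m) j)) = - pairprod M D"
    if "\<And>i j. D j i = - D i j" "Suc m < M" for m M and D :: "nat \<Rightarrow> nat \<Rightarrow> 'a"
    using that
  proof (induction m arbitrary: D M)
    case 0
    show ?case using swap01[OF 0(1), of M] 0(2) by simp
  next
    case (Suc m)
    obtain M' where M: "M = Suc M'" "Suc m < M'" using Suc.prems(2) by (cases M) auto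
    define D' where "D' = (\<lambda>i j. D (?sw 0 1 i) (?sw 0 1 j))"
    have D': "D' j i = - D' i j" for i j unfolding D'_def by (rule Suc.prems(1))
    have conj: "?sw 0 (Suc (Suc m)) i = ?sw 0 1 (?sw 1 (Suc (Suc m)) (?sw 0 1 i))" for i
      by (simp add: Transposition.transpose_def)
    have shift: "?sw 1 (Suc (Suc m)) (Suc i) = Suc (?sw 0 (Suc m) i)" "?sw 1 (Suc (Suc m)) 0 = 0" for i
      by (auto simp: Transposition.transpose_def)
    have "pairprod M (\<lambda>i j. D (?sw 0 (Suc (Suc m)) i) (?sw 0 (Suc (Suc m)) j))
        = - pairprod M (\<lambda>i j. D' (?sw 1 (Suc (Suc m)) i) (?sw 1 (Suc (Suc m)) j))"
      unfolding conj D'_def using Suc.prems(2)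
      by (intro swap01[of "\<lambda>i j. D (?sw 0 1 (?sw 1 (Suc (Suc m)) i)) (?sw 0 1 (?sw 1 (Suc (Suc m)) j))"]
          Suc.prems(1)) simp
    also have "pairprod M (\<lambda>i j. D' (?sw 1 (Suc (Suc m)) i) (?sw 1 (Suc (Suc m)) j))
        = (\<Prod>j<M'. D' 0 (Suc (?sw 0 (Suc m) j)))
          * pairprod M' (\<lambda>i j. D' (Suc (?sw 0 (Suc m) i)) (Suc (?sw 0 (Suc m) j)))"
      unfolding M(1) pairprod_Suc_shift shift ..
    also have "(\<Prod>j<M'. D' 0 (Suc (?sw 0 (Suc m) j))) = (\<Prod>j<M'. D' 0 (Suc j))"
      using prod.permute[OF permutes_swap_id[of 0 "{..<M'}" "Suc m"], of "\<lambda>j. D' 0 (Suc j)"] M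
      by (simp add: comp_def)
    also have "pairprod M' (\<lambda>i j. D' (Suc (?sw 0 (Suc m) i)) (Suc (?sw 0 (Suc m) j)))
        = - pairprod M' (\<lambda>i j. D' (Suc i) (Suc j))"
      by (rule Suc.IH[OF _ M(2)]) (rule D')
    also have "- ((\<Prod>j<M'. D' 0 (Suc j)) * - pairprod M' (\<lambda>i j. D' (Suc i) (Suc j))) = pairprod M D'"
      unfolding M(1) pairprod_Suc_shift by simp
    also have "\<dots> = - pairprod M D"
      unfolding D'_def using Suc.prems(2) by (intro swap01 Suc.prems(1)) simp
    finally show ?case .
  qed
  from this[of D "m - 1", OF assms(1)] show ?thesis
    using assms(2) by (cases "m = 0") (simp_all add: sign_swap_id)
qed

subsection \<open>Littlewood's expansion\<close>

text \<open>Formally 1 + x^(2p) = x^p (x^p + x^(-p)), and x^p + x^(-p) is a monic polynomial in x +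
  1/x; the induction step is its Chebyshev-type recurrence with denominators cleared. For p = 0 the
  value is 2, so monicity fails there and p = 2 is treated separately.\<close>

lemma one_plus_power_expansion:
  assumes "p > 0"
  shows "\<exists>c. c 0 = 1 \<and> (\<forall>x::'a::comm_ring_1. 1 + x ^ (2 * p) = (\<Sum>j\<le>p. c j * x ^ j * (1 + x\<^sup>2) ^ (p - j)))"
  using assms
proof (induction p rule: less_induct)
  case (less p)
  consider "p = 1" | "p = 2" | "p \<ge> 3" using less.prems by linarith
  then show ?case
  proof cases
    case 1
    then show ?thesis
      by (intro exI[of _ "\<lambda>j. of_bool (j = 0)"]) (simp add: power2_eq_square)
  next
    case 2
    then show ?thesis
      by (intro exI[of _ "\<lambda>j. if j = 0 then 1 else if j = 2 then -2 else 0"])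
        (simp add: numeral_2_eq_2 algebra_simps)
  next
    case 3
    define m where "m = p - 2"
    have m: "p = Suc (Suc m)" "m > 0" using 3 by (auto simp: m_def)
    obtain c where c: "c 0 = 1"
      "\<And>x::'a. 1 + x ^ (2 * Suc m) = (\<Sum>j\<le>Suc m. c j * x ^ j * (1 + x\<^sup>2) ^ (Suc m - j))"
      using less.IH[of "Suc m"] m by auto
    obtain d where d: "\<And>x::'a. 1 + x ^ (2 * m) = (\<Sum>j\<le>m. d j * x ^ j * (1 + x\<^sup>2) ^ (m - j))"
      using less.IH[of m] m by auto
    define e where "e = (\<lambda>j. (if j \<le> Suc m then c j else 0) - (if j \<ge> 2 then d (j - 2) else 0))"
    have "1 + x ^ (2 * p) = (\<Sum>j\<le>p. e j * x ^ j * (1 + x\<^sup>2) ^ (p - j))" for x :: 'a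
    proof -
      have "1 + x ^ (2 * p) = (1 + x\<^sup>2) * (1 + x ^ (2 * Suc m)) - x\<^sup>2 * (1 + x ^ (2 * m))"
        unfolding m(1) by (simp add: algebra_simps power2_eq_square)
      also have "(1 + x\<^sup>2) * (1 + x ^ (2 * Suc m))
          = (\<Sum>j\<le>p. (if j \<le> Suc m then c j else 0) * x ^ j * (1 + x\<^sup>2) ^ (p - j))"
        unfolding c(2) m(1) sum_distrib_left
        by (simp add: Suc_diff_le mult_ac)
      also have "x\<^sup>2 * (1 + x ^ (2 * m))
          = (\<Sum>j\<le>p. (if j \<ge> 2 then d (j - 2) else 0) * x ^ j * (1 + x\<^sup>2) ^ (p - j))"
        unfolding d m(1) sum_distrib_left sum.atMost_Suc_shift
        by (simp add: power2_eq_square mult_ac)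
      finally show ?thesis
        by (simp only: e_def sum_subtractf[symmetric] left_diff_distrib)
    qed
    moreover have "e 0 = 1" using c by (simp add: e_def)
    ultimately show ?thesis by blast
  qed
qed

text \<open>Wedging the exponent sequences of \<^term>\<open>Pset (Suc p)\<close> splits off the column
  \<open>1 + x ^ (2 * p)\<close>, which modulo the other columns equals \<open>(1 + x\<^sup>2) ^ p\<close>.\<close>

lemma sum_Pset_fdet:
  fixes x w :: "nat \<Rightarrow> 'a::comm_ring_1"
  assumes "k + p \<le> N"
  shows "(\<Sum>lam\<in>Pset p. (-1) ^ (part_size lam div 2) * fdet N (\<lambda>i j.
      if k \<le> j \<and> j < k + p then w i * x i ^ (lam (p - 1 - (j - k)) + (j - k)) else B i j))
    = fdet N (\<lambda>i j. if k \<le> j \<and> j < k + p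
        then w i * (x i ^ (j - k) * (1 + (x i)\<^sup>2) ^ (p - 1 - (j - k))) else B i j)"
  using assms
\<comment> \<open>Splitting off column k moves the remaining block one place to the right, turns its
  weight into \<open>w i * x i\<close> and puts the split column among \<open>B\<close>; hence all
  three vary.\<close>
proof (induction p arbitrary: k w B)
  case 0
  show ?case unfolding Pset_0 by (auto simp: part_size_def part_length_def intro!: fdet_cong)
next
  case (Suc p)
  show ?case
  proof (cases "p = 0")
    case True
    show ?thesis
      unfolding True Pset_1
      by (auto simp: part_size_def part_length_def less_Suc_eq intro!: fdet_cong)
  next
    case False
    let ?S = "\<lambda>lam i j. if Suc k \<le> j \<and> j < Suc k + p
        then w i * x i * x i ^ (lam (p - 1 - (j - Suc k)) + (j - Suc k)) else B i j"
    have cases: thesis if "j < k \<Longrightarrow> thesis" "j = k \<Longrightarrow> thesis"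
      "\<And>t. t < p \<Longrightarrow> j = Suc (k + t) \<Longrightarrow> thesis" "j \<ge> k + Suc p \<Longrightarrow> thesis" for j thesis
      using that(3)[of "j - Suc k"] that(1,2,4) by linarith
    have eq1: "fdet N (\<lambda>i j. if k \<le> j \<and> j < k + Suc p
          then w i * x i ^ (lam (Suc p - 1 - (j - k)) + (j - k)) else B i j)
        = fdet N (\<lambda>i j. if j = k then w i * 1 else ?S lam i j)"
      if "lam \<in> Pset p" for lam
    proof (rule fdet_cong)
      fix i j
      show "(if k \<le> j \<and> j < k + Suc p then w i * x i ^ (lam (Suc p - 1 - (j - k)) + (j - k))
          else B i j) = (if j = k then w i * 1 else ?S lam i j)"
        using that by (cases rule: cases[of j]) (auto simp: Pset_iff power_add mult_ac)
    qed
    \<comment> \<open>The first row of the hook gives the exponent 2p in the last column of the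
      block. Moved to the front, it leaves exactly the columns belonging to \<open>lam\<close>, so
      the two partitions \<open>lam\<close> and \<open>hook_ext p lam\<close> differ in a single
      column.\<close>
    have eq2: "fdet N (\<lambda>i j. if k \<le> j \<and> j < k + Suc p
          then w i * x i ^ (hook_ext p lam (Suc p - 1 - (j - k)) + (j - k)) else B i j)
        = (-1) ^ p * fdet N (\<lambda>i j. if j = k then w i * x i ^ (2 * p) else ?S lam i j)" for lam
    proof -
      have "(if k \<le> j' \<and> j' < k + Suc p
          then w i * x i ^ (hook_ext p lam (Suc p - 1 - (j' - k)) + (j' - k)) else B i j')
        = (if j = k then w i * x i ^ (2 * p) else ?S lam i j)"
        if j': "j' = (if j < k then j else if j < k + 1 then j + p else if j < k + 1 + p then j - 1 else j)"
        for i j j'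
      proof -
        show ?thesis
        proof (cases rule: cases[of j])
          case (3 t)
          then show ?thesis
            by (simp add: j' hook_ext_def power_add mult_ac)
        qed (auto simp: j' hook_ext_def mult_2)
      qed
      then show ?thesis
        by (subst fdet_swap_col_blocks[of k p 1]) (use Suc.prems in simp_all)
    qed
    obtain c where c: "c 0 = 1"
      "\<And>x::'a. 1 + x ^ (2 * p) = (\<Sum>j\<le>p. c j * x ^ j * (1 + x\<^sup>2) ^ (p - j))"
      using one_plus_power_expansion[of p] False by auto
    let ?R = "\<lambda>i j. if k \<le> j \<and> j < k + Suc p
        then w i * (x i ^ (j - k) * (1 + (x i)\<^sup>2) ^ (Suc p - 1 - (j - k))) else B i j"
    \<comment> \<open>Since \<open>c 0 = 1\<close>, the column 1 + x^(2p) is column k of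
      \<open>?R\<close> plus these multiples of the p columns to its right. Ranks must therefore
      decrease from left to right.\<close>
    let ?E = "\<lambda>r j. if j = k \<and> k < r \<and> r \<le> k + p then c (r - k) else 0"
    have "(\<Sum>lam\<in>Pset (Suc p). (-1) ^ (part_size lam div 2) * fdet N (\<lambda>i j.
        if k \<le> j \<and> j < k + Suc p then w i * x i ^ (lam (Suc p - 1 - (j - k)) + (j - k)) else B i j))
      = (\<Sum>lam\<in>Pset p. (-1) ^ (part_size lam div 2)
          * (fdet N (\<lambda>i j. if j = k then w i * 1 else ?S lam i j)
            + fdet N (\<lambda>i j. if j = k then w i * x i ^ (2 * p) else ?S lam i j)))"
      using False unfolding sum_Pset_Suc[OF False[unfolded neq0_conv]]
      by (intro sum.cong refl)
        (simp only: eq1 eq2 part_size_hook_ext neq0_conv, simp add: power_add algebra_simps flip: power_mult_distrib)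
    also have "\<dots> = (\<Sum>lam\<in>Pset p. (-1) ^ (part_size lam div 2)
          * fdet N (\<lambda>i j. if Suc k \<le> j \<and> j < Suc k + p
              then w i * x i * x i ^ (lam (p - 1 - (j - Suc k)) + (j - Suc k))
              else if j = k then w i * 1 + w i * x i ^ (2 * p) else B i j))"
      using Suc.prems
      by (intro sum.cong refl arg_cong2[of _ _ _ _ "(*)"], subst fdet_add_col[symmetric])
        (auto intro!: fdet_cong)
    also have "\<dots> = fdet N (\<lambda>i j. if Suc k \<le> j \<and> j < Suc k + p
        then w i * x i * (x i ^ (j - Suc k) * (1 + (x i)\<^sup>2) ^ (p - 1 - (j - Suc k)))
        else if j = k then w i * 1 + w i * x i ^ (2 * p) else B i j)"
      using Suc.prems by (intro Suc.IH) simp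
    also have "\<dots> = fdet N (\<lambda>i j. ?R i j + (\<Sum>r<N. ?R i r * ?E r j))"
    proof (rule fdet_cong)
      fix i j assume "j < N"
      show "(if Suc k \<le> j \<and> j < Suc k + p
          then w i * x i * (x i ^ (j - Suc k) * (1 + (x i)\<^sup>2) ^ (p - 1 - (j - Suc k)))
          else if j = k then w i * 1 + w i * x i ^ (2 * p) else B i j)
        = ?R i j + (\<Sum>r<N. ?R i r * ?E r j)"
      proof (cases "j = k")
        case True
        have "(\<Sum>r<N. ?R i r * ?E r k)
            = (\<Sum>r\<in>(\<lambda>s. k + Suc s) ` {..<p}. ?R i r * ?E r k)"
        proof (rule sum.mono_neutral_right)
          show "(\<lambda>s. k + Suc s) ` {..<p} \<subseteq> {..<N}" using Suc.prems by auto
          show "\<forall>r\<in>{..<N} - (\<lambda>s. k + Suc s) ` {..<p}. ?R i r * ?E r k = 0"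
          proof
            fix r assume r: "r \<in> {..<N} - (\<lambda>s. k + Suc s) ` {..<p}"
            have "\<not> (k < r \<and> r \<le> k + p)"
            proof
              assume "k < r \<and> r \<le> k + p"
              then have "r = k + Suc (r - Suc k)" "r - Suc k < p" by auto
              then show False using r by blast
            qed
            then show "?R i r * ?E r k = 0" by auto
          qed
        qed simp
        also have "\<dots> = (\<Sum>s<p. w i * (c (Suc s) * x i ^ Suc s * (1 + (x i)\<^sup>2) ^ (p - Suc s)))"
          by (subst sum.reindex) (auto simp: inj_on_def mult_ac intro!: sum.cong)
        finally have "?R i k + (\<Sum>r<N. ?R i r * ?E r k) = w i * (1 + x i ^ (2 * p))"
          unfolding c(2) sum.atMost_shift using c(1)
          by (simp add: sum_distrib_left algebra_simps)
        then show ?thesis using True by (simp add: distrib_left)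
      next
        case False
        show ?thesis
        proof (cases "Suc k \<le> j")
          case True
          then show ?thesis using False
            by (simp flip: power_Suc mult.assoc add: Suc_diff_Suc)
              (simp add: mult.assoc Suc_diff_Suc flip: power_Suc)
        qed (use False in auto)
      qed
    qed
    also have "\<dots> = fdet N ?R"
      by (rule fdet_col_operations[where \<rho> = "\<lambda>j. N - j"]) (use Suc.prems in auto)
    finally show ?thesis .
  qed
qed

text \<open>A homogeneous version of the matrix \<open>V\<^sup>p\<^sup>,\<^sup>q\<close> with empty partitions,
  with additional weights f for the first family of columns.\<close>

definition hvdet :: "nat \<Rightarrow> nat \<Rightarrow> (nat \<Rightarrow> 'a::comm_ring_1) \<Rightarrow> (nat \<Rightarrow> 'a) \<Rightarrow> (nat \<Rightarrow> 'a) \<Rightarrow> (nat \<Rightarrow> 'a) \<Rightarrow> 'a"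
  where "hvdet p q u v f g = fdet (p + q) (\<lambda>i j.
      if j < p then f i * (v i ^ j * u i ^ (p - 1 - j))
      else g i * (v i ^ (j - p) * u i ^ (q - 1 - (j - p))))"

text \<open>The sign splits into a factor for each partition because both sizes are even. The two
  sums are then evaluated one after the other, the inner one acting on the last q columns and the
  outer one on the first p.\<close>

lemma Ffun_eq_hvdet: "Ffun p q x a = hvdet p q (\<lambda>i. 1 + (x i)\<^sup>2) x (\<lambda>_. 1) a"
proof -
  let ?V = "\<lambda>lam mu i j. if j < p then x i ^ (lam (p - 1 - j) + j)
      else a i * x i ^ (mu (q - 1 - (j - p)) + (j - p))"
  have "Ffun p q x a = (\<Sum>lam\<in>Pset p. (-1) ^ (part_size lam div 2) *
      (\<Sum>mu\<in>Pset q. (-1) ^ (part_size mu div 2) * fdet (p + q) (?V lam mu)))"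
    unfolding Ffun_def Vmat_def fdet_def sum_distrib_left
  proof (intro sum.cong refl)
    fix lam mu assume "lam \<in> Pset p" "mu \<in> Pset q"
    then have "(part_size lam + part_size mu) div 2 = part_size lam div 2 + part_size mu div 2"
      by (intro div_plus_div_distrib_dvd_left even_part_size)
    then show "(-1) ^ ((part_size lam + part_size mu) div 2)
        * det (mat (p + q) (p + q) (\<lambda>(i, j). ?V lam mu i j))
      = (-1) ^ (part_size lam div 2) * ((-1) ^ (part_size mu div 2)
        * det (mat (p + q) (p + q) (\<lambda>(i, j). ?V lam mu i j)))"
      by (simp add: power_add mult.assoc)
  qed
  also have "\<dots> = (\<Sum>lam\<in>Pset p. (-1) ^ (part_size lam div 2) * fdet (p + q) (\<lambda>i j.
      if 0 \<le> j \<and> j < 0 + p then 1 * x i ^ (lam (p - 1 - (j - 0)) + (j - 0))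
      else a i * (x i ^ (j - p) * (1 + (x i)\<^sup>2) ^ (q - 1 - (j - p)))))"
  proof (intro sum.cong refl arg_cong2[of _ _ _ _ "(*)"])
    fix lam
    have "(\<Sum>mu\<in>Pset q. (-1) ^ (part_size mu div 2) * fdet (p + q) (?V lam mu))
      = (\<Sum>mu\<in>Pset q. (-1) ^ (part_size mu div 2) * fdet (p + q) (\<lambda>i j.
        if p \<le> j \<and> j < p + q then a i * x i ^ (mu (q - 1 - (j - p)) + (j - p))
        else x i ^ (lam (p - 1 - j) + j)))"
      by (intro sum.cong refl arg_cong2[of _ _ _ _ "(*)"] fdet_cong) auto
    also have "\<dots> = fdet (p + q) (\<lambda>i j. if p \<le> j \<and> j < p + q
        then a i * (x i ^ (j - p) * (1 + (x i)\<^sup>2) ^ (q - 1 - (j - p)))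
        else x i ^ (lam (p - 1 - j) + j))"
      by (rule sum_Pset_fdet) simp
    finally show "(\<Sum>mu\<in>Pset q. (-1) ^ (part_size mu div 2) * fdet (p + q) (?V lam mu))
      = fdet (p + q) (\<lambda>i j. if 0 \<le> j \<and> j < 0 + p then 1 * x i ^ (lam (p - 1 - (j - 0)) + (j - 0))
      else a i * (x i ^ (j - p) * (1 + (x i)\<^sup>2) ^ (q - 1 - (j - p))))"
      by (auto intro!: fdet_cong)
  qed
  also have "\<dots> = hvdet p q (\<lambda>i. 1 + (x i)\<^sup>2) x (\<lambda>_. 1) a"
    by (subst sum_Pset_fdet) (auto simp: hvdet_def intro!: fdet_cong)
  finally show ?thesis .
qed

subsection \<open>Expansion of Pfaffians\<close>

abbreviation (input) swap :: "nat \<Rightarrow> nat \<Rightarrow> nat \<Rightarrow> nat" where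
  "swap \<equiv> Transposition.transpose"

text \<open>A permutation never pairs an index with itself, so diagonal entries are invisible to the
  Pfaffian.\<close>

lemma pfaffian_cong:
  assumes "\<And>i j. i < 2 * n \<Longrightarrow> j < 2 * n \<Longrightarrow> i \<noteq> j \<Longrightarrow> A i j = B i j"
  shows "pfaffian n A = pfaffian n B"
proof -
  have "A (\<sigma> (2 * i)) (\<sigma> (2 * i + 1)) = B (\<sigma> (2 * i)) (\<sigma> (2 * i + 1))"
    if "\<sigma> permutes {..<2 * n}" "i < n" for \<sigma> i
    using permutes_in_image[OF that(1), of "2 * i"] permutes_in_image[OF that(1), of "2 * i + 1"]
      inj_eq[OF permutes_inj[OF that(1)], of "2 * i" "2 * i + 1"] that(2)
    by (intro assms) auto
  then show ?thesis by (simp add: pfaffian_def)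
qed

lemma pfaffian_scale: "pfaffian n (\<lambda>i j. c * A i j) = c ^ n * pfaffian n A"
  by (simp add: pfaffian_def prod.distrib sum_distrib_left mult_ac)

definition lift2 :: "(nat \<Rightarrow> nat) \<Rightarrow> nat \<Rightarrow> nat" where
  "lift2 \<rho> k = (if k < 2 then k else \<rho> (k - 2) + 2)"

lemma lift2_comp: "lift2 (\<rho> \<circ> \<rho>') = lift2 \<rho> \<circ> lift2 \<rho>'"
  by (auto simp: lift2_def fun_eq_iff)

lemma lift2_id: "lift2 id = id"
  by (auto simp: lift2_def fun_eq_iff)

lemma lift2_swap: "lift2 (swap a b) = swap (a + 2) (b + 2)"
  by (auto simp: lift2_def fun_eq_iff Transposition.transpose_def)

lemma lift2_permutes_sign:
  assumes "\<rho> permutes {..<m}"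
  shows "lift2 \<rho> permutes {..<m + 2} \<and> sign (lift2 \<rho>) = sign \<rho>"
  using assms finite_lessThan
proof (induction rule: permutes_induct)
  case id
  then show ?case using permutes_id[of "{..<m + 2}"] by (simp only: lift2_id)
next
  case (swap a b \<rho>)
  have perm: "permutation (lift2 \<rho>)" "permutation \<rho>"
    using swap by (auto simp: permutation_permutes intro: finite_lessThan)
  have "swap (a + 2) (b + 2) permutes {..<m + 2}"
    using swap by (intro permutes_swap_id) auto
  then have "lift2 (swap a b \<circ> \<rho>) permutes {..<m + 2}"
    unfolding lift2_comp lift2_swap using swap by (blast intro: permutes_compose)
  moreover have "sign (lift2 (swap a b \<circ> \<rho>)) = sign (swap a b \<circ> \<rho>)"
    unfolding lift2_comp lift2_swap sign_compose[OF permutation_swap_id perm(1)]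
      sign_compose[OF permutation_swap_id perm(2)] using swap by (simp add: sign_swap_id)
  ultimately show ?case ..
qed

lemma unlift2_permutes:
  assumes "\<pi> permutes {..<m + 2}" "\<pi> 0 = 0" "\<pi> 1 = 1"
  shows "(\<lambda>k. \<pi> (k + 2) - 2) permutes {..<m}"
    and "lift2 (\<lambda>k. \<pi> (k + 2) - 2) = \<pi>"
proof -
  have inj: "inj \<pi>" using assms permutes_inj by blast
  have ge: "\<pi> k \<ge> 2" if "k \<ge> 2" for k
    using inj_eq[OF inj, of k 0] inj_eq[OF inj, of k 1] assms(2,3) that by auto
  have inv: "Hilbert_Choice.inv \<pi> 0 = 0" "Hilbert_Choice.inv \<pi> 1 = 1" using assms inj by (metis inv_f_f)+
  have inj': "inj (Hilbert_Choice.inv \<pi>)" using assms permutes_inj permutes_inv by blast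
  have ge': "Hilbert_Choice.inv \<pi> k \<ge> 2" if "k \<ge> 2" for k
    using inj_eq[OF inj', of k 0] inj_eq[OF inj', of k 1] inv that by auto
  have e: "\<pi> (k + 2) - 2 + 2 = \<pi> (k + 2)"
    and e': "Hilbert_Choice.inv \<pi> (k + 2) - 2 + 2 = Hilbert_Choice.inv \<pi> (k + 2)" for k
    using ge[of "k + 2"] ge'[of "k + 2"] by simp_all
  have "bij (\<lambda>k. \<pi> (k + 2) - 2)"
  proof (rule o_bij[where g = "\<lambda>k. Hilbert_Choice.inv \<pi> (k + 2) - 2"])
    show "(\<lambda>k. Hilbert_Choice.inv \<pi> (k + 2) - 2) \<circ> (\<lambda>k. \<pi> (k + 2) - 2) = id"
      by (simp only: fun_eq_iff comp_def e inv_f_f[OF inj]) simp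
    show "(\<lambda>k. \<pi> (k + 2) - 2) \<circ> (\<lambda>k. Hilbert_Choice.inv \<pi> (k + 2) - 2) = id"
      by (simp only: fun_eq_iff comp_def e' permutes_inverses[OF assms(1)]) simp
  qed
  moreover have "\<pi> (k + 2) - 2 = k" if "k \<notin> {..<m}" for k
    using that assms(1) by (auto simp: permutes_def)
  ultimately show "(\<lambda>k. \<pi> (k + 2) - 2) permutes {..<m}"
    by (auto simp: permutes_def bij_iff)
  show "lift2 (\<lambda>k. \<pi> (k + 2) - 2) = \<pi>"
  proof
    fix k
    show "lift2 (\<lambda>k. \<pi> (k + 2) - 2) k = \<pi> k"
    proof (cases "k < 2")
      case True
      then show ?thesis using assms(2,3) by (auto simp: lift2_def less_2_cases_iff)
    next
      case False
      then obtain l where "k = l + 2" using le_Suc_ex[of 2 k] by (auto simp: add.commute)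
      then show ?thesis using e[of l] by (simp add: lift2_def)
    qed
  qed
qed

context
  fixes n :: nat and A :: "nat \<Rightarrow> nat \<Rightarrow> 'a::field_char_0"
  assumes skew: "\<And>i j. i < 2 * Suc n \<Longrightarrow> j < 2 * Suc n \<Longrightarrow> i \<noteq> j \<Longrightarrow> A j i = - A i j"
begin

private definition pf_term :: "(nat \<Rightarrow> nat) \<Rightarrow> 'a" where
  "pf_term \<sigma> = of_int (sign \<sigma>) * (\<Prod>i<Suc n. A (\<sigma> (2 * i)) (\<sigma> (2 * i + 1)))"

private abbreviation "Perms \<equiv> {\<sigma>. \<sigma> permutes {..<2 * Suc n}}"

private lemma pf_term_swap_within:
  assumes "\<sigma> \<in> Perms" "i < Suc n"
  shows "pf_term (\<sigma> \<circ> swap (2 * i) (2 * i + 1)) = pf_term \<sigma>"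
proof -
  let ?\<tau> = "swap (2 * i) (2 * i + 1)"
  have perm: "permutation \<sigma>" using assms by (auto simp: permutation_permutes)
  have flip: "A (\<sigma> (2 * i + 1)) (\<sigma> (2 * i)) = - A (\<sigma> (2 * i)) (\<sigma> (2 * i + 1))"
    using assms permutes_in_image[of \<sigma> "{..<2 * Suc n}" "2 * i"]
      permutes_in_image[of \<sigma> "{..<2 * Suc n}" "2 * i + 1"] inj_eq[OF permutes_inj, of \<sigma> _ "2 * i" "2 * i + 1"]
    by (intro skew) auto
  have other: "?\<tau> (2 * k) = 2 * k" "?\<tau> (2 * k + 1) = 2 * k + 1" if "k \<noteq> i" for k
    using that by (auto simp: Transposition.transpose_def)
  have "(\<Prod>k<Suc n. A ((\<sigma> \<circ> ?\<tau>) (2 * k)) ((\<sigma> \<circ> ?\<tau>) (2 * k + 1)))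
      = - (\<Prod>k<Suc n. A (\<sigma> (2 * k)) (\<sigma> (2 * k + 1)))"
    using assms(2) flip
    by (subst (1 2) prod.remove[of _ i]) (auto simp del: prod.lessThan_Suc simp: other intro!: prod.cong)
  then show ?thesis
    using perm by (simp add: pf_term_def sign_compose permutation_swap_id sign_swap_id del: prod.lessThan_Suc)
qed

text \<open>Exchanging two whole pairs is an even permutation that only reorders the
  factors.\<close>

private lemma pf_term_swap_pairs:
  assumes "\<sigma> \<in> Perms" "i < Suc n"
  shows "pf_term (\<sigma> \<circ> (swap 0 (2 * i) \<circ> swap 1 (2 * i + 1))) = pf_term \<sigma>"
proof -
  let ?\<tau> = "swap 0 (2 * i) \<circ> swap 1 (2 * i + 1)"
  have perm: "permutation \<sigma>" using assms by (auto simp: permutation_permutes)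
  have \<tau>: "?\<tau> (2 * k) = 2 * swap 0 i k" "?\<tau> (2 * k + 1) = 2 * swap 0 i k + 1" for k
    by (auto simp: Transposition.transpose_def, presburger+)
  have "sign ?\<tau> = 1"
    by (simp add: sign_compose permutation_swap_id sign_swap_id)
  moreover have "permutation ?\<tau>"
    by (intro permutation_compose permutation_swap_id)
  moreover have "(\<Prod>k<Suc n. A ((\<sigma> \<circ> ?\<tau>) (2 * k)) ((\<sigma> \<circ> ?\<tau>) (2 * k + 1)))
      = (\<Prod>k<Suc n. A (\<sigma> (2 * k)) (\<sigma> (2 * k + 1)))"
    unfolding comp_def[of \<sigma>] \<tau>
    using prod.permute[OF permutes_swap_id[of 0 "{..<Suc n}" i],
        of "\<lambda>k. A (\<sigma> (2 * k)) (\<sigma> (2 * k + 1))"] assms(2)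
    by (simp add: comp_def)
  ultimately show ?thesis
    using perm unfolding pf_term_def by (simp only: sign_compose mult_1_right)
qed

private lemma sum_pf_term_comp:
  assumes "\<tau> permutes {..<2 * Suc n}" "\<tau> \<circ> \<tau> = id" "\<tau> m' = m"
    and "\<And>\<sigma>. \<sigma> \<in> Perms \<Longrightarrow> pf_term (\<sigma> \<circ> \<tau>) = pf_term \<sigma>"
  shows "(\<Sum>\<sigma> | \<sigma> \<in> Perms \<and> \<sigma> m = 0. pf_term \<sigma>) = (\<Sum>\<sigma> | \<sigma> \<in> Perms \<and> \<sigma> m' = 0. pf_term \<sigma>)"
proof (rule sum.reindex_bij_witness[where i = "\<lambda>\<sigma>. \<sigma> \<circ> \<tau>" and j = "\<lambda>\<sigma>. \<sigma> \<circ> \<tau>"])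
  have "\<tau> m = m'" using assms(2,3) by (metis comp_apply id_apply)
  then show "\<sigma> \<circ> \<tau> \<in> {\<sigma> \<in> Perms. \<sigma> m = 0}" if "\<sigma> \<in> {\<sigma> \<in> Perms. \<sigma> m' = 0}" for \<sigma>
    using that assms(1) permutes_compose by auto
  show "\<sigma> \<circ> \<tau> \<in> {\<sigma> \<in> Perms. \<sigma> m' = 0}" if "\<sigma> \<in> {\<sigma> \<in> Perms. \<sigma> m = 0}" for \<sigma>
    using that assms(1,3) permutes_compose by auto
qed (use assms(2,4) in \<open>auto simp: comp_assoc\<close>)

text \<open>Exchanging pairs carries the index 0 between even positions, and a swap inside a pair
  carries it to the odd one; neither changes a term.\<close>

private lemma sum_pf_term_position:
  assumes "m < 2 * Suc n"
  shows "(\<Sum>\<sigma> | \<sigma> \<in> Perms \<and> \<sigma> m = 0. pf_term \<sigma>) = (\<Sum>\<sigma> | \<sigma> \<in> Perms \<and> \<sigma> 0 = 0. pf_term \<sigma>)"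
proof -
  have even: "(\<Sum>\<sigma> | \<sigma> \<in> Perms \<and> \<sigma> (2 * i) = 0. pf_term \<sigma>)
      = (\<Sum>\<sigma> | \<sigma> \<in> Perms \<and> \<sigma> 0 = 0. pf_term \<sigma>)" if "i < Suc n" for i
  proof (rule sum_pf_term_comp[where \<tau> = "swap 0 (2 * i) \<circ> swap 1 (2 * i + 1)"])
    show "swap 0 (2 * i) \<circ> swap 1 (2 * i + 1) permutes {..<2 * Suc n}"
      using that by (intro permutes_compose permutes_swap_id) auto
    show "swap 0 (2 * i) \<circ> swap 1 (2 * i + 1) \<circ> (swap 0 (2 * i) \<circ> swap 1 (2 * i + 1)) = id"
      by (auto simp: fun_eq_iff Transposition.transpose_def)
  qed (use that pf_term_swap_pairs in \<open>auto simp: Transposition.transpose_def\<close>)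
  show ?thesis
  proof (cases "even m")
    case True
    then show ?thesis using even[of "m div 2"] assms by auto
  next
    case False
    then obtain i where i: "m = 2 * i + 1" by (elim oddE)
    have "(\<Sum>\<sigma> | \<sigma> \<in> Perms \<and> \<sigma> m = 0. pf_term \<sigma>) = (\<Sum>\<sigma> | \<sigma> \<in> Perms \<and> \<sigma> (2 * i) = 0. pf_term \<sigma>)"
    proof (rule sum_pf_term_comp[where \<tau> = "swap (2 * i) (2 * i + 1)"])
      show "swap (2 * i) (2 * i + 1) permutes {..<2 * Suc n}"
        using assms i by (intro permutes_swap_id) auto
    qed (use assms i pf_term_swap_within in auto)
    then show ?thesis using even[of i] assms i by simp
  qed
qed

text \<open>Composing with \<open>swap 1 j\<close> makes the permutation fix 0 and 1, so that it is
  the lift of a permutation of the remaining 2n indices.\<close>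

private lemma sum_pf_term_fixed:
  assumes "1 \<le> j" "j < 2 * Suc n"
  shows "(\<Sum>\<sigma> | \<sigma> \<in> Perms \<and> \<sigma> 0 = 0 \<and> \<sigma> 1 = j. pf_term \<sigma>)
    = (\<Sum>\<rho> | \<rho> permutes {..<2 * n}. of_int (sign (swap 1 j)) * A 0 j * (of_int (sign \<rho>) *
        (\<Prod>i<n. A (swap 1 j (\<rho> (2 * i) + 2)) (swap 1 j (\<rho> (2 * i + 1) + 2)))))"
proof (rule sum.reindex_bij_witness[where j = "\<lambda>\<sigma>. \<lambda>k. (swap 1 j \<circ> \<sigma>) (k + 2) - 2"
      and i = "\<lambda>\<rho>. swap 1 j \<circ> lift2 \<rho>"])
  have sw: "swap 1 j permutes {..<2 * n + 2}" using assms by (intro permutes_swap_id) auto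
  have sw0: "swap 1 j 0 = 0" using assms by (auto simp: Transposition.transpose_def)
  have unlift: "(\<lambda>k. (swap 1 j \<circ> \<sigma>) (k + 2) - 2) permutes {..<2 * n}"
    "lift2 (\<lambda>k. (swap 1 j \<circ> \<sigma>) (k + 2) - 2) = swap 1 j \<circ> \<sigma>"
    if "\<sigma> \<in> {\<sigma>. \<sigma> \<in> Perms \<and> \<sigma> 0 = 0 \<and> \<sigma> 1 = j}" for \<sigma>
    using unlift2_permutes[of "swap 1 j \<circ> \<sigma>" "2 * n"] that sw sw0 by (auto intro: permutes_compose)
  show "(\<lambda>k. (swap 1 j \<circ> \<sigma>) (k + 2) - 2) \<in> {\<rho>. \<rho> permutes {..<2 * n}}"
    if "\<sigma> \<in> {\<sigma>. \<sigma> \<in> Perms \<and> \<sigma> 0 = 0 \<and> \<sigma> 1 = j}" for \<sigma>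
    using unlift(1)[OF that] by simp
  show "swap 1 j \<circ> lift2 (\<lambda>k. (swap 1 j \<circ> \<sigma>) (k + 2) - 2) = \<sigma>"
    if "\<sigma> \<in> {\<sigma>. \<sigma> \<in> Perms \<and> \<sigma> 0 = 0 \<and> \<sigma> 1 = j}" for \<sigma>
    unfolding unlift(2)[OF that] by (simp add: fun_eq_iff)
  show "swap 1 j \<circ> lift2 \<rho> \<in> {\<sigma>. \<sigma> \<in> Perms \<and> \<sigma> 0 = 0 \<and> \<sigma> 1 = j}"
    if "\<rho> \<in> {\<rho>. \<rho> permutes {..<2 * n}}" for \<rho>
    using lift2_permutes_sign[of \<rho> "2 * n"] that sw sw0
    by (auto intro: permutes_compose simp: lift2_def)
  show "(\<lambda>k. (swap 1 j \<circ> (swap 1 j \<circ> lift2 \<rho>)) (k + 2) - 2) = \<rho>" for \<rho>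
    by (simp add: fun_eq_iff lift2_def)
  show "of_int (sign (swap 1 j)) * A 0 j * (of_int (sign (\<lambda>k. (swap 1 j \<circ> \<sigma>) (k + 2) - 2)) *
      (\<Prod>i<n. A (swap 1 j ((swap 1 j \<circ> \<sigma>) (2 * i + 2) - 2 + 2))
        (swap 1 j ((swap 1 j \<circ> \<sigma>) (2 * i + 1 + 2) - 2 + 2)))) = pf_term \<sigma>"
    if \<sigma>: "\<sigma> \<in> {\<sigma>. \<sigma> \<in> Perms \<and> \<sigma> 0 = 0 \<and> \<sigma> 1 = j}" for \<sigma>
  proof -
    define \<rho> where "\<rho> = (\<lambda>k. (swap 1 j \<circ> \<sigma>) (k + 2) - 2)"
    note unlift' = unlift[OF \<sigma>, folded \<rho>_def]
    have "\<sigma> = swap 1 j \<circ> lift2 \<rho>"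
      unfolding unlift'(2) by (simp add: fun_eq_iff)
    moreover have "permutation (lift2 \<rho>)"
      using lift2_permutes_sign[OF unlift'(1)] permutation_permutes finite_lessThan by blast
    ultimately have sign: "sign \<sigma> = sign (swap 1 j) * sign \<rho>"
      using lift2_permutes_sign[OF unlift'(1)] by (metis sign_compose permutation_swap_id)
    have undo: "swap 1 j (\<rho> k + 2) = \<sigma> (k + 2)" for k
      using fun_cong[OF unlift'(2), of "k + 2"] by (simp add: lift2_def)
    have "of_int (sign (swap 1 j)) * A 0 j * (of_int (sign \<rho>) *
        (\<Prod>i<n. A (swap 1 j (\<rho> (2 * i) + 2)) (swap 1 j (\<rho> (2 * i + 1) + 2)))) = pf_term \<sigma>"
      unfolding pf_term_def sign undo prod.lessThan_Suc_shift using \<sigma>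
      by (simp add: mult_ac)
    then show ?thesis by (simp only: \<rho>_def)
  qed
qed

text \<open>Grouping permutations by the position of 0 gives 2(n + 1) equal sums, which reduces the
  normalisation to 2^n n!. The minors list their indices in the order induced by
  \<open>swap 1 j\<close> rather than increasingly, so the sign is that of a transposition, not an
  alternating one.\<close>

lemma pfaffian_expand:
  "pfaffian (Suc n) A = (\<Sum>j\<in>{1..<2 * Suc n}. of_int (sign (swap 1 j)) * A 0 j
    * pfaffian n (\<lambda>k l. A (swap 1 j (k + 2)) (swap 1 j (l + 2))))" (is "_ = ?R")
proof -
  have fin: "finite Perms" by (intro finite_permutations) simp
  have inv_eq: "Hilbert_Choice.inv \<sigma> 0 = m \<longleftrightarrow> \<sigma> m = 0" if "\<sigma> \<in> Perms" for \<sigma> m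
    using that permutes_inverses[of \<sigma>] by (metis mem_Collect_eq)
  have "(\<Sum>\<sigma>\<in>Perms. pf_term \<sigma>)
      = (\<Sum>m<2 * Suc n. \<Sum>\<sigma> | \<sigma> \<in> Perms \<and> Hilbert_Choice.inv \<sigma> 0 = m. pf_term \<sigma>)"
  proof (intro sum.group[symmetric])
    have "Hilbert_Choice.inv \<sigma> 0 \<in> {..<2 * Suc n}" if "\<sigma> \<in> Perms" for \<sigma>
      using that permutes_in_image[OF permutes_inv, of \<sigma> "{..<2 * Suc n}" 0] by simp
    then show "(\<lambda>\<sigma>. Hilbert_Choice.inv \<sigma> 0) ` Perms \<subseteq> {..<2 * Suc n}" by blast
  qed (use fin in simp_all)
  also have "\<dots> = (\<Sum>m<2 * Suc n. \<Sum>\<sigma> | \<sigma> \<in> Perms \<and> \<sigma> m = 0. pf_term \<sigma>)"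
    using inv_eq by (intro sum.cong Collect_cong conj_cong refl) simp
  also have "\<dots> = of_nat (2 * Suc n) * (\<Sum>\<sigma> | \<sigma> \<in> Perms \<and> \<sigma> 0 = 0. pf_term \<sigma>)"
    by (subst sum.cong[OF refl sum_pf_term_position]) (simp_all only: lessThan_iff sum_constant card_lessThan)
  also have "(\<Sum>\<sigma> | \<sigma> \<in> Perms \<and> \<sigma> 0 = 0. pf_term \<sigma>)
      = (\<Sum>j\<in>{1..<2 * Suc n}. \<Sum>\<sigma> | \<sigma> \<in> {\<sigma> \<in> Perms. \<sigma> 0 = 0} \<and> \<sigma> 1 = j. pf_term \<sigma>)"
  proof (intro sum.group[symmetric])
    have "\<sigma> 1 \<in> {1..<2 * Suc n}" if "\<sigma> \<in> Perms" "\<sigma> 0 = 0" for \<sigma>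
      using that permutes_in_image[of \<sigma> "{..<2 * Suc n}" 1] inj_eq[OF permutes_inj, of \<sigma> _ 1 0]
      by (auto simp: Suc_le_eq)
    then show "(\<lambda>\<sigma>. \<sigma> 1) ` {\<sigma> \<in> Perms. \<sigma> 0 = 0} \<subseteq> {1..<2 * Suc n}" by blast
  qed (use fin in auto)
  also have "\<dots> = (\<Sum>j\<in>{1..<2 * Suc n}. of_int (sign (swap 1 j)) * A 0 j
    * pfaffian n (\<lambda>k l. A (swap 1 j (k + 2)) (swap 1 j (l + 2)))) * (2 ^ n * fact n)"
    unfolding sum_distrib_right
  proof (intro sum.cong refl)
    fix j assume "j \<in> {1..<2 * Suc n}"
    then show "(\<Sum>\<sigma> | \<sigma> \<in> {\<sigma> \<in> Perms. \<sigma> 0 = 0} \<and> \<sigma> 1 = j. pf_term \<sigma>)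
      = of_int (sign (swap 1 j)) * A 0 j
        * pfaffian n (\<lambda>k l. A (swap 1 j (k + 2)) (swap 1 j (l + 2))) * (2 ^ n * fact n)"
      using sum_pf_term_fixed[of j] by (simp add: pfaffian_def sum_distrib_left conj_assoc)
  qed
  finally have "(\<Sum>\<sigma>\<in>Perms. pf_term \<sigma>) = of_nat (2 * Suc n) * (?R * (2 ^ n * fact n))" .
  moreover have "of_nat (2 * Suc n) * (X * (2 ^ n * fact n)) = X * (2 ^ Suc n * fact (Suc n))" for X :: 'a
    by (simp add: algebra_simps)
  moreover have "(2::'a) ^ Suc n * fact (Suc n) \<noteq> 0"
    by (simp del: fact_Suc)
  ultimately show ?thesis
    unfolding pfaffian_def[of "Suc n"] pf_term_def[symmetric]
    by (simp only: nonzero_mult_div_cancel_right not_False_eq_True)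
qed

end

subsection \<open>The Pfaffian identity without \<open>z\<close> and \<open>w\<close>\<close>

lemma fdet_2: "fdet 2 F = F 0 0 * F 1 1 - F 0 1 * F 1 0"
proof -
  have "{\<sigma>. \<sigma> permutes {0..<2::nat}} = {id, swap 0 1}"
    by (auto simp: permutes_doubleton_iff numeral_2_eq_2 atLeast0_lessThan_Suc insert_commute)
  moreover have "id \<noteq> swap 0 1" by (metis id_apply transpose_apply_first zero_neq_one)
  ultimately show ?thesis
    by (simp add: fdet_rows sign_swap_id numeral_2_eq_2)
qed

lemma hvdet_cong:
  assumes "\<And>i. i < p + q \<Longrightarrow> u i = u' i \<and> v i = v' i \<and> f i = f' i \<and> g i = g' i"
  shows "hvdet p q u v f g = hvdet p q u' v' f' g'"
  unfolding hvdet_def using assms by (intro fdet_cong) auto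

lemma hvdet_permute:
  assumes "\<pi> permutes {0..<p + q}"
  shows "hvdet p q (u \<circ> \<pi>) (v \<circ> \<pi>) (f \<circ> \<pi>) (g \<circ> \<pi>) = of_int (sign \<pi>) * hvdet p q u v f g"
  unfolding hvdet_def comp_def by (rule fdet_permute_rows[OF assms])

lemma hvdet_1_1: "hvdet 1 1 u v f g = f 0 * g 1 - f 1 * g 0"
  unfolding hvdet_def one_add_one fdet_2 by (simp add: mult.commute)

text \<open>Reversing the columns inside each block exchanges u and v. Recording only that the sign
  squares to 1 is enough, because determinants will occur in pairs.\<close>

lemma hvdet_reverse:
  obtains s :: "'a::comm_ring_1" where "s * s = 1" "\<And>u v f g. hvdet n n u v f g = s * hvdet n n v u f g"
proof -
  define \<pi> where "\<pi> j = (if j < n then n - 1 - j else if j < 2 * n then n + (2 * n - 1 - j) else j)" for j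
  have inv: "\<pi> (\<pi> j) = j" for j by (auto simp: \<pi>_def)
  have "\<pi> permutes {0..<n + n}"
    unfolding permutes_def by (intro conjI allI impI ex1I[of _ "\<pi> _"]) (auto simp: inv, auto simp: \<pi>_def)
  then have "hvdet n n u v f g = of_int (sign \<pi>) * hvdet n n v u f g" for u v f g :: "nat \<Rightarrow> 'a"
    unfolding hvdet_def
  proof (subst fdet_permute_cols[symmetric], assumption, intro fdet_cong)
    fix i j assume "j < n + n"
    then consider "j < n" | t where "t < n" "j = n + t"
      by (metis add_less_cancel_left le_Suc_ex not_le)
    then show "(if j < n then f i * (v i ^ j * u i ^ (n - 1 - j))
        else g i * (v i ^ (j - n) * u i ^ (n - 1 - (j - n))))
      = (if \<pi> j < n then f i * (u i ^ \<pi> j * v i ^ (n - 1 - \<pi> j))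
        else g i * (u i ^ (\<pi> j - n) * v i ^ (n - 1 - (\<pi> j - n))))"
      by cases (auto simp: \<pi>_def mult.commute)
  qed
  moreover have "of_int (sign \<pi>) * of_int (sign \<pi>) = (1::'a)"
    by (metis of_int_1 of_int_mult sign_idempotent)
  ultimately show ?thesis using that by blast
qed

text \<open>Subtracting \<open>v 1 / u 1\<close> times the preceding column makes every column but
  the first of each block vanish on rows 0 and 1. Bringing those two first columns together costs
  (-1)^n and leaves a block triangular matrix; the powers of \<open>u 1\<close> from its 2 x 2
  corner cancel the denominators.\<close>

lemma hvdet_coincident_aux:
  fixes u v f g :: "nat \<Rightarrow> 'a::field"
  assumes eq: "u 0 = u 1" "v 0 = v 1" and nz: "u 1 \<noteq> 0"
  shows "hvdet (Suc n) (Suc n) u v f g = (-1) ^ n * (f 0 * g 1 - f 1 * g 0)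
    * (\<Prod>i<2 * n. u 1 * v (i + 2) - u (i + 2) * v 1)
    * hvdet n n (\<lambda>i. u (i + 2)) (\<lambda>i. v (i + 2)) (\<lambda>i. f (i + 2)) (\<lambda>i. g (i + 2))"
proof -
  define N where "N = Suc n + Suc n"
  let ?F = "\<lambda>i j. if j < Suc n then f i * (v i ^ j * u i ^ (Suc n - 1 - j))
      else g i * (v i ^ (j - Suc n) * u i ^ (Suc n - 1 - (j - Suc n)))"
  let ?E = "\<lambda>k j. if Suc k = j \<and> j \<noteq> Suc n then - v 1 / u 1 else 0"
  define d where "d i = (u 1 * v i - u i * v 1) / u 1" for i
  let ?G = "\<lambda>i j. if j = 0 then f i * u i ^ n else if j < Suc n then d i * (f i * (v i ^ (j - 1) * u i ^ (n - j)))
      else if j = Suc n then g i * u i ^ n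
      else d i * (g i * (v i ^ (j - n - 2) * u i ^ (n - 1 - (j - n - 2))))"
  have "fdet N (\<lambda>i j. ?F i j + (\<Sum>k<N. ?F i k * ?E k j)) = fdet N ?F"
    by (rule fdet_col_operations[where \<rho> = id]) auto
  also have "fdet N (\<lambda>i j. ?F i j + (\<Sum>k<N. ?F i k * ?E k j)) = fdet N ?G"
  proof (rule fdet_cong)
    fix i j assume "j < N"
    show "?F i j + (\<Sum>k<N. ?F i k * ?E k j) = ?G i j"
    proof (cases "j = 0 \<or> j = Suc n")
      case True
      then have "(\<Sum>k<N. ?F i k * ?E k j) = 0" by (intro sum.neutral) auto
      then show ?thesis using True by auto
    next
      case False
      then obtain t where t: "j = Suc t" "t \<noteq> n" by (cases j) auto
      have "(\<Sum>k<N. ?F i k * ?E k j) = ?F i t * (- v 1 / u 1)"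
        using t \<open>j < N\<close> by (subst sum.remove[of _ t]) (auto intro!: sum.neutral)
      moreover have "?F i j + ?F i t * (- v 1 / u 1) = ?G i j"
      proof (cases "t < n")
        case True
        then obtain e where "n = Suc (t + e)" using less_iff_Suc_add by auto
        then show ?thesis using t nz by (simp add: d_def field_simps)
      next
        case False
        then obtain e where e: "t = Suc (n + e)" using t by (metis less_imp_Suc_add linorder_neqE_nat)
        then obtain e' where "n = Suc (e + e')" using \<open>j < N\<close> t less_iff_Suc_add[of e n] by (auto simp: N_def)
        then show ?thesis using t nz e by (simp add: d_def field_simps)
      qed
      ultimately show ?thesis by simp
    qed
  qed
  finally have "hvdet (Suc n) (Suc n) u v f g = fdet N ?G" by (simp add: hvdet_def N_def)
  also have "\<dots> = (-1) ^ n * fdet (2 + 2 * n) (\<lambda>i j. ?G i (if j < 1 then j else if j < 1 + 1 then j + n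
      else if j < 1 + 1 + n then j - 1 else j))" (is "_ = _ * fdet _ ?H")
    by (subst fdet_swap_col_blocks[of 1 n 1 N]) (simp_all add: N_def mult_2)
  also have "fdet (2 + 2 * n) ?H = fdet 2 ?H * fdet (2 * n) (\<lambda>i j. ?H (2 + i) (2 + j))"
  proof (rule fdet_block_upper_right_zero)
    fix i j assume "i < (2::nat)"
    then have "d i = 0" using eq by (auto simp: d_def less_2_cases_iff)
    then show "?H i (2 + j) = 0" by auto
  qed
  also have "fdet 2 ?H = (f 0 * g 1 - f 1 * g 0) * u 1 ^ (2 * n)"
    unfolding fdet_2 using eq by (simp add: power_mult power2_eq_square power_mult_distrib algebra_simps)
  also have "fdet (2 * n) (\<lambda>i j. ?H (2 + i) (2 + j)) = fdet (2 * n) (\<lambda>i j. d (i + 2) *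
      (if j < n then f (i + 2) * (v (i + 2) ^ j * u (i + 2) ^ (n - 1 - j))
      else g (i + 2) * (v (i + 2) ^ (j - n) * u (i + 2) ^ (n - 1 - (j - n)))))"
    by (rule fdet_cong) auto
  also have "\<dots> = (\<Prod>i<2 * n. d (i + 2))
    * hvdet n n (\<lambda>i. u (i + 2)) (\<lambda>i. v (i + 2)) (\<lambda>i. f (i + 2)) (\<lambda>i. g (i + 2))"
    unfolding fdet_scale_rows hvdet_def mult_2 ..
  also have "(\<Prod>i<2 * n. d (i + 2)) = (\<Prod>i<2 * n. u 1 * v (i + 2) - u (i + 2) * v 1) / u 1 ^ (2 * n)"
    by (simp add: d_def prod_dividef)
  finally show ?thesis using nz by simp
qed

text \<open>If \<open>u 1 = 0\<close>, the roles of u and v are exchanged; the product has an even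
  number of factors and keeps its sign. It matters that s is chosen before f and g: the two
  determinants of the Pfaffian identity share it.\<close>

lemma hvdet_coincident:
  fixes u v :: "nat \<Rightarrow> 'a::field"
  assumes eq: "u 0 = u 1" "v 0 = v 1" and nz: "u 1 \<noteq> 0 \<or> v 1 \<noteq> 0"
  obtains s where "s * s = 1"
    "\<And>f g. hvdet (Suc n) (Suc n) u v f g = s * ((f 0 * g 1 - f 1 * g 0)
      * (\<Prod>i<2 * n. u 1 * v (i + 2) - u (i + 2) * v 1)
      * hvdet n n (\<lambda>i. u (i + 2)) (\<lambda>i. v (i + 2)) (\<lambda>i. f (i + 2)) (\<lambda>i. g (i + 2)))"
proof (cases "u 1 = 0")
  case False
  then show ?thesis
    using hvdet_coincident_aux[OF eq] by (intro that[of "(-1) ^ n"]) (auto simp flip: power_mult_distrib)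
next
  case True
  then have "v 1 \<noteq> 0" using nz by simp
  obtain s :: 'a where s: "s * s = 1" "\<And>u v f g. hvdet (Suc n) (Suc n) u v f g = s * hvdet (Suc n) (Suc n) v u f g"
    using hvdet_reverse by blast
  obtain s' :: 'a where s': "s' * s' = 1" "\<And>u v f g. hvdet n n u v f g = s' * hvdet n n v u f g"
    using hvdet_reverse by blast
  have "(\<Prod>i<2 * n. v 1 * u (i + 2) - v (i + 2) * u 1)
      = (\<Prod>i<2 * n. - 1 * (u 1 * v (i + 2) - u (i + 2) * v 1))"
    by (intro prod.cong) (auto simp: algebra_simps)
  also have "\<dots> = (\<Prod>i<2 * n. u 1 * v (i + 2) - u (i + 2) * v 1)"
    unfolding prod.distrib by simp
  finally have P: "(\<Prod>i<2 * n. v 1 * u (i + 2) - v (i + 2) * u 1)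
    = (\<Prod>i<2 * n. u 1 * v (i + 2) - u (i + 2) * v 1)" .
  show ?thesis
  proof (rule that)
    have "(s * s' * (-1) ^ n) * (s * s' * (-1) ^ n) = (s * s) * (s' * s') * ((-1) ^ n * (-1) ^ n)"
      by (simp only: mult_ac)
    then show "(s * s' * (-1) ^ n) * (s * s' * (-1) ^ n) = 1"
      by (simp add: s s' flip: power_mult_distrib)
    show "hvdet (Suc n) (Suc n) u v f g = (s * s' * (-1) ^ n) * ((f 0 * g 1 - f 1 * g 0)
      * (\<Prod>i<2 * n. u 1 * v (i + 2) - u (i + 2) * v 1)
      * hvdet n n (\<lambda>i. u (i + 2)) (\<lambda>i. v (i + 2)) (\<lambda>i. f (i + 2)) (\<lambda>i. g (i + 2)))" for f g
      unfolding s(2)[of u v] hvdet_coincident_aux[OF eq(2,1) \<open>v 1 \<noteq> 0\<close>] P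
        s'(2)[of "\<lambda>i. v (i + 2)" "\<lambda>i. u (i + 2)"] by (simp add: mult_ac)
  qed
qed

lemma hom2_hvdet_first_row:
  "hom2 n (\<lambda>U V. hvdet (Suc n) (Suc n) (u(0 := U)) (v(0 := V)) f g)"
  unfolding hvdet_def
proof (rule hom2_fdet)
  show "hom2 n (\<lambda>U V. if j < Suc n then f 0 * ((v(0 := V)) 0 ^ j * (u(0 := U)) 0 ^ (Suc n - 1 - j))
      else g 0 * ((v(0 := V)) 0 ^ (j - Suc n) * (u(0 := U)) 0 ^ (Suc n - 1 - (j - Suc n))))"
    if "j < Suc n + Suc n" for j
    using that by (cases "j < Suc n") (auto intro!: hom2_monomial)
  show "hom2 0 (\<lambda>U V. if j < Suc n then f i * ((v(0 := V)) i ^ j * (u(0 := U)) i ^ (Suc n - 1 - j))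
      else g i * ((v(0 := V)) i ^ (j - Suc n) * (u(0 := U)) i ^ (Suc n - 1 - (j - Suc n))))"
    if "0 < i" for i j
    using that by (simp only: fun_upd_apply gr_implies_not0 if_False hom2_const)
qed simp

lemma prod_atLeastLessThan_1: "(\<Prod>k\<in>{1..<Suc M}. X k) = (\<Prod>j<M. X (Suc j))"
  unfolding One_nat_def prod.atLeast_Suc_lessThan_Suc_shift by (simp add: lessThan_atLeast0)

text \<open>After clearing the denominators involving the index 0, both sides are binary forms of
  degree \<open>2 * n\<close> in \<open>(u 0, v 0)\<close>. They agree at the \<open>2 * n + 1\<close> points \<open>(u m, v m)\<close> with \<open>m > 0\<close>:
  there only one term of the expansion along the first row survives, and on the right two rows
  of each determinant involve the same powers.\<close>

lemma pfaffian_hvdet_core: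
  fixes u v f g h k :: "nat \<Rightarrow> 'a::field_char_0"
  assumes "\<And>i j. i < 2 * n \<Longrightarrow> j < 2 * n \<Longrightarrow> i \<noteq> j \<Longrightarrow> u i * v j - u j * v i \<noteq> 0"
  shows "pfaffian n (\<lambda>i j. (f i * g j - f j * g i) * (h i * k j - h j * k i) / (u i * v j - u j * v i))
    = hvdet n n u v f g * hvdet n n u v h k / pairprod (2 * n) (\<lambda>i j. u i * v j - u j * v i)"
  using assms
proof (induction n arbitrary: u v f g h k)
  case 0
  show ?case by (simp add: pfaffian_def hvdet_def pairprod_def)
next
  case (Suc n)
  define N where "N = 2 * Suc n"
  define D where "D i j = u i * v j - u j * v i" for i j
  define Q where "Q i j = (f i * g j - f j * g i) * (h i * k j - h j * k i)" for i j
  define A where "A i j = Q i j / D i j" for i j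
  define \<epsilon> :: "nat \<Rightarrow> 'a" where "\<epsilon> j = of_int (sign (swap 1 j))" for j
  have \<epsilon>: "\<epsilon> j * \<epsilon> j = 1" for j by (simp add: \<epsilon>_def flip: of_int_mult)
  have nz: "D i j \<noteq> 0" if "i < N" "j < N" "i \<noteq> j" for i j
    using Suc.prems that by (simp add: D_def N_def)
  have swD: "D j i = - D i j" for i j by (simp add: D_def)
  have sw: "swap 1 m (i + 2) \<in> {1..<N} - {m}" if "m \<in> {1..<N}" "i < 2 * n" for m i
    using that by (auto simp: Transposition.transpose_def N_def)
  have sw_inj: "swap 1 m i = swap 1 m j \<longleftrightarrow> i = j" for m i j
    by (simp add: inj_eq[OF inj_transpose])
  \<comment> \<open>\<open>K m\<close> and \<open>W m\<close> belong to the 2n indices other than 0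
    and m, in the order in which the Pfaffian expansion lists them.\<close>
  define K where "K m f g = hvdet n n (\<lambda>i. u (swap 1 m (i + 2))) (\<lambda>i. v (swap 1 m (i + 2)))
      (\<lambda>i. f (swap 1 m (i + 2))) (\<lambda>i. g (swap 1 m (i + 2)))" for m f g
  define W where "W m = pairprod (2 * n) (\<lambda>i j. D (swap 1 m (i + 2)) (swap 1 m (j + 2)))" for m
  define c where "c m = K m f g * K m h k / W m" for m
  have IH: "pfaffian n (\<lambda>i j. A (swap 1 m (i + 2)) (swap 1 m (j + 2))) = c m" if "m \<in> {1..<N}" for m
    unfolding A_def Q_def D_def c_def K_def W_def
  proof (rule Suc.IH)
    fix i j assume "i < 2 * n" "j < 2 * n" "i \<noteq> j"
    then have "D (swap 1 m (i + 2)) (swap 1 m (j + 2)) \<noteq> 0"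
      using sw[OF that, of i] sw[OF that, of j] sw_inj[of m "i + 2" "j + 2"] by (intro nz) auto
    then show "u (swap 1 m (i + 2)) * v (swap 1 m (j + 2)) - u (swap 1 m (j + 2)) * v (swap 1 m (i + 2)) \<noteq> 0"
      by (simp only: D_def not_False_eq_True)
  qed
  have "pfaffian (Suc n) A = (\<Sum>j\<in>{1..<2 * Suc n}. of_int (sign (swap 1 j)) * A 0 j
    * pfaffian n (\<lambda>k l. A (swap 1 j (k + 2)) (swap 1 j (l + 2))))"
  proof (rule pfaffian_expand)
    show "A j i = - A i j" for i j
      using swD[of i j] by (simp add: A_def Q_def algebra_simps)
  qed
  then have expand: "pfaffian (Suc n) A = (\<Sum>j\<in>{1..<N}. \<epsilon> j * A 0 j * c j)"
    using IH by (simp add: N_def \<epsilon>_def)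
  define P where "P = (\<Prod>k\<in>{1..<N}. D 0 k)"
  have "P \<noteq> 0" using nz by (auto simp: P_def N_def)
  define T where "T = pairprod (Suc (2 * n)) (\<lambda>i j. D (Suc i) (Suc j))"
  have PT: "pairprod (2 * Suc n) D = P * T"
    using pairprod_Suc_shift[of "Suc (2 * n)" D] prod_atLeastLessThan_1[of "D 0" "Suc (2 * n)"]
    unfolding P_def T_def N_def by (simp only: mult_Suc_right add_2_eq_Suc)
  \<comment> \<open>Only the coordinates of point 0 become variables. Its weights stay fixed, so
    \<open>Q 0 j\<close> is a constant, and multiplication by \<open>P\<close> has removed the
    denominators.\<close>
  define L where "L U V = (\<Sum>j\<in>{1..<N}. \<epsilon> j * Q 0 j * c j * (\<Prod>k\<in>{1..<N} - {j}. U * v k - u k * V))" for U V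
  define R where "R U V = 1 / T * (hvdet (Suc n) (Suc n) (u(0 := U)) (v(0 := V)) f g
      * hvdet (Suc n) (Suc n) (u(0 := U)) (v(0 := V)) h k)" for U V
  have L0: "L (u 0) (v 0) = pfaffian (Suc n) A * P"
    unfolding expand L_def sum_distrib_right
  proof (rule sum.cong[OF refl])
    fix j assume j: "j \<in> {1..<N}"
    then have "P = D 0 j * (\<Prod>k\<in>{1..<N} - {j}. D 0 k)" unfolding P_def by (intro prod.remove) auto
    moreover have "D 0 j \<noteq> 0" using j by (intro nz) auto
    ultimately show "\<epsilon> j * Q 0 j * c j * (\<Prod>k\<in>{1..<N} - {j}. u 0 * v k - u k * v 0) = \<epsilon> j * A 0 j * c j * P"
      by (simp add: A_def D_def[of 0])
  qed
  have "L U V = R U V" for U V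
  proof (rule hom2_eq[where F = L and G = R and m = "2 * n" and I = "{1..<N}" and a = u and b = v])
    have "hom2 (2 * n) (\<lambda>U V. \<Prod>k\<in>{1..<N} - {j}. U * v k - u k * V)" if "j \<in> {1..<N}" for j
    proof -
      have "hom2 (\<Sum>k\<in>{1..<N} - {j}. 1) (\<lambda>U V. \<Prod>k\<in>{1..<N} - {j}. U * v k - u k * V)"
        by (intro hom2_prod hom2_linear) simp
      moreover have "(\<Sum>k\<in>{1..<N} - {j}. 1) = 2 * n"
        using that by (simp add: N_def)
      ultimately show ?thesis by (simp only:)
    qed
    then show "hom2 (2 * n) L"
      unfolding L_def by (intro hom2_sum hom2_cmult) auto
    show "hom2 (2 * n) R"
      unfolding R_def mult_2 by (intro hom2_cmult hom2_mult hom2_hvdet_first_row)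
    show "u i * v j \<noteq> u j * v i" if "i \<in> {1..<N}" "j \<in> {1..<N}" "i \<noteq> j" for i j
      using nz[of i j] that by (simp add: D_def)
    show "L (u m) (v m) = R (u m) (v m)" if m: "m \<in> {1..<N}" for m
    proof -
      let ?sw = "swap 1 m"
      define X where "X = (\<Prod>i<2 * n. D m (?sw (i + 2)))"
      have X: "X = (\<Prod>k\<in>{1..<N} - {m}. D m k)"
        unfolding X_def
      proof (rule prod.reindex_bij_witness[where j = "\<lambda>i. ?sw (i + 2)" and i = "\<lambda>k. ?sw k - 2"])
        fix k assume k: "k \<in> {1..<N} - {m}"
        then have "?sw k \<ge> 2" "?sw k < N" using m by (auto simp: Transposition.transpose_def)
        then show "?sw (?sw k - 2 + 2) = k" "?sw k - 2 \<in> {..<2 * n}"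
          by (simp_all only: le_add_diff_inverse2 transpose_involutory) (auto simp: N_def)
      qed (use sw[OF m] in auto)
      have "X \<noteq> 0" using nz m by (auto simp: X)
      have "L (u m) (v m) = \<epsilon> m * Q 0 m * c m * X"
      proof -
        have "(\<Prod>k\<in>{1..<N} - {j}. u m * v k - u k * v m) = 0" if "j \<in> {1..<N} - {m}" for j
          using m that by (intro prod_zero) auto
        then have "(\<Sum>j\<in>{1..<N} - {m}. \<epsilon> j * Q 0 j * c j
            * (\<Prod>k\<in>{1..<N} - {j}. u m * v k - u k * v m)) = 0"
          by (intro sum.neutral ballI) (simp only: mult_zero_right)
        then show ?thesis
          unfolding L_def X D_def using m by (subst sum.remove[of _ m]) simp_all
      qed
      moreover have "R (u m) (v m) = \<epsilon> m * Q 0 m * c m * X"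
      proof -
        \<comment> \<open>Renumbering by \<open>swap 1 m\<close> puts the coinciding rows 0 and m
          first and the others in the order used by \<open>K m\<close>.\<close>
        let ?u = "u(0 := u m) \<circ> ?sw" and ?v = "v(0 := v m) \<circ> ?sw"
        have sw01: "?sw 0 = 0" "?sw 1 = m" using m by (auto simp: Transposition.transpose_def)
        have "D 0 m \<noteq> 0" using m by (intro nz) auto
        then have nz1: "?u 1 \<noteq> 0 \<or> ?v 1 \<noteq> 0" using m by (auto simp: D_def)
        have eq1: "?u 0 = ?u 1" "?v 0 = ?v 1" using m sw01 by auto
        obtain s where s: "s * s = 1" "\<And>f g. hvdet (Suc n) (Suc n) ?u ?v f g = s * ((f 0 * g 1 - f 1 * g 0)
          * (\<Prod>i<2 * n. ?u 1 * ?v (i + 2) - ?u (i + 2) * ?v 1)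
          * hvdet n n (\<lambda>i. ?u (i + 2)) (\<lambda>i. ?v (i + 2)) (\<lambda>i. f (i + 2)) (\<lambda>i. g (i + 2)))"
          by (rule hvdet_coincident[OF eq1 nz1]) blast
        have tail: "?u (i + 2) = u (?sw (i + 2))" "?v (i + 2) = v (?sw (i + 2))" if "i < 2 * n" for i
          using sw[OF m that] by auto
        have perm: "?sw permutes {0..<Suc n + Suc n}"
          using m by (intro permutes_swap_id) (auto simp: N_def)
        have H: "hvdet (Suc n) (Suc n) (u(0 := u m)) (v(0 := v m)) f g
            = \<epsilon> m * s * ((f 0 * g m - f m * g 0) * X * K m f g)" for f g
        proof -
          have "hvdet (Suc n) (Suc n) ?u ?v (f \<circ> ?sw) (g \<circ> ?sw)
              = \<epsilon> m * hvdet (Suc n) (Suc n) (u(0 := u m)) (v(0 := v m)) f g"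
            unfolding \<epsilon>_def by (rule hvdet_permute[OF perm])
          then have "hvdet (Suc n) (Suc n) (u(0 := u m)) (v(0 := v m)) f g
              = \<epsilon> m * hvdet (Suc n) (Suc n) ?u ?v (f \<circ> ?sw) (g \<circ> ?sw)"
            using \<epsilon>[of m] by (simp flip: mult.assoc)
          also have "hvdet (Suc n) (Suc n) ?u ?v (f \<circ> ?sw) (g \<circ> ?sw)
              = s * ((f 0 * g m - f m * g 0) * X * K m f g)"
          proof -
            have "(\<Prod>i<2 * n. ?u 1 * ?v (i + 2) - ?u (i + 2) * ?v 1) = X"
              unfolding X_def D_def using m sw01 by (intro prod.cong refl) (simp only: tail lessThan_iff, simp)
            moreover have "hvdet n n (\<lambda>i. ?u (i + 2)) (\<lambda>i. ?v (i + 2)) (\<lambda>i. (f \<circ> ?sw) (i + 2)) (\<lambda>i. (g \<circ> ?sw) (i + 2))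
                = K m f g"
              unfolding K_def by (rule hvdet_cong) (simp only: tail mult_2[symmetric], simp)
            ultimately show ?thesis unfolding s(2) using sw01 by simp
          qed
          finally show ?thesis by (simp only: mult.assoc)
        qed
        \<comment> \<open>Bringing m to the front of the indices 1, ..., N - 1 separates the pairs
          containing m, collected in \<open>X\<close>, from the rest.\<close>
        have "T = \<epsilon> m * (X * W m)"
        proof -
          have shift: "Suc (swap 0 (m - 1) i) = ?sw (Suc i)" for i
            using m by (auto simp: Transposition.transpose_def)
          have "pairprod (Suc (2 * n)) (\<lambda>i j. D (Suc (swap 0 (m - 1) i)) (Suc (swap 0 (m - 1) j)))
              = of_int (sign (swap 0 (m - 1))) * T"
            unfolding T_def using m
            by (intro pairprod_swap[of "\<lambda>i j. D (Suc i) (Suc j)"] swD) (auto simp: N_def)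
          moreover have "of_int (sign (swap 0 (m - 1))) = \<epsilon> m"
            using m by (auto simp: \<epsilon>_def sign_swap_id)
          moreover have "pairprod (Suc (2 * n)) (\<lambda>i j. D (?sw (Suc i)) (?sw (Suc j))) = X * W m"
            unfolding pairprod_Suc_shift using sw01 by (simp add: X_def W_def)
          ultimately have "X * W m = \<epsilon> m * T" unfolding shift by simp
          then show ?thesis using \<epsilon>[of m] by (simp flip: mult.assoc)
        qed
        then have "1 / T = 1 / \<epsilon> m * (1 / X) * (1 / W m)" by simp
        moreover have "1 / \<epsilon> m = \<epsilon> m"
          using \<epsilon>[of m] by (metis mult_zero_left nonzero_divide_eq_eq zero_neq_one)
        ultimately have "1 / T = \<epsilon> m * (1 / X) * (1 / W m)" by (simp only:)
        \<comment> \<open>Each determinant contributes \<open>\<epsilon> m * s * X\<close>: these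
          signs square away, and one \<open>X\<close> is cancelled by \<open>T\<close>, whose own
          sign remains.\<close>
        then have "R (u m) (v m) = \<epsilon> m * (\<epsilon> m * \<epsilon> m) * (s * s) * Q 0 m * c m * (X * X * (1 / X))"
          unfolding R_def H Q_def c_def by (simp add: mult_ac)
        then show ?thesis using \<epsilon>[of m] s(1) \<open>X \<noteq> 0\<close> by simp
      qed
      ultimately show ?thesis by simp
    qed
  qed (simp_all add: N_def)
  then have "pfaffian (Suc n) A * P = R (u 0) (v 0)" using L0 by simp
  also have "\<dots> = hvdet (Suc n) (Suc n) u v f g * hvdet (Suc n) (Suc n) u v h k / T"
    by (simp add: R_def)
  finally have "pfaffian (Suc n) A = hvdet (Suc n) (Suc n) u v f g * hvdet (Suc n) (Suc n) u v h k / (P * T)"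
    using nonzero_eq_divide_eq[OF \<open>P \<noteq> 0\<close>] by (metis divide_divide_eq_left mult.commute)
  then show ?case
    unfolding PT[symmetric] by (simp only: A_def[abs_def] Q_def D_def[abs_def])
qed

subsection \<open>Reduction for generic \<open>z\<close> and \<open>w\<close>\<close>

text \<open>\<phi> and \<psi> are the two combinations of columns with leading terms \<open>F * U ^ p\<close> and \<open>G * U ^ q\<close>
  that vanish on all rows indexed by z; their multiples by \<open>V ^ k * U ^ (n - 1 - k)\<close> serve as new
  columns and make the matrix block triangular.\<close>

lemma hvdet_reduce:
  fixes uz vz fz gz :: "nat \<Rightarrow> 'a::field"
  assumes vz: "\<And>i. i < p + q \<Longrightarrow> vz i \<noteq> 0" and nz: "hvdet p q uz vz fz gz \<noteq> 0"
  obtains \<phi> \<psi> :: "'a \<Rightarrow> 'a \<Rightarrow> 'a \<Rightarrow> 'a \<Rightarrow> 'a" where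
    "\<And>n u v f g. hvdet (n + p) (n + q) (vconcat (2 * n) u uz) (vconcat (2 * n) v vz)
        (vconcat (2 * n) f fz) (vconcat (2 * n) g gz)
      = (-1) ^ (n * (n + p)) * (\<Prod>i<p + q. vz i) ^ n * hvdet p q uz vz fz gz
        * hvdet n n u v (\<lambda>i. \<psi> (u i) (v i) (f i) (g i)) (\<lambda>i. \<phi> (u i) (v i) (f i) (g i))"
proof -
  \<comment> \<open>The columns of the small matrix times V. The extra V makes each multiple by
    \<open>V ^ k * U ^ (n - 1 - k)\<close> a column of the large matrix lying strictly after number
    k of its block. It also puts the product of the \<open>vz i\<close> into the determinant of the
    linear systems.\<close>
  define b where "b j U V F G = V * (if j < p then F * (V ^ j * U ^ (p - 1 - j))
      else G * (V ^ (j - p) * U ^ (q - 1 - (j - p))))" for j and U V F G :: 'a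
  have "fdet (p + q) (\<lambda>i j. b j (uz i) (vz i) (fz i) (gz i)) \<noteq> 0"
    unfolding b_def fdet_scale_rows hvdet_def[symmetric] using vz nz by (simp add: prod_zero_iff)
  note solve = fdet_nonzero_solve[OF this]
  obtain y1 where y1: "\<And>i. i < p + q \<Longrightarrow>
      (\<Sum>j<p + q. b j (uz i) (vz i) (fz i) (gz i) * y1 j) = - (fz i * uz i ^ p)"
    by (rule solve[where b = "\<lambda>i. - (fz i * uz i ^ p)"]) blast
  obtain y2 where y2: "\<And>i. i < p + q \<Longrightarrow>
      (\<Sum>j<p + q. b j (uz i) (vz i) (fz i) (gz i) * y2 j) = - (gz i * uz i ^ q)"
    by (rule solve[where b = "\<lambda>i. - (gz i * uz i ^ q)"]) blast
  define \<phi> where "\<phi> U V F G = F * U ^ p + (\<Sum>j<p + q. b j U V F G * y1 j)" for U V F G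
  define \<psi> where "\<psi> U V F G = G * U ^ q + (\<Sum>j<p + q. b j U V F G * y2 j)" for U V F G
  have "hvdet (n + p) (n + q) (vconcat (2 * n) u uz) (vconcat (2 * n) v vz)
        (vconcat (2 * n) f fz) (vconcat (2 * n) g gz)
      = (-1) ^ (n * (n + p)) * (\<Prod>i<p + q. vz i) ^ n * hvdet p q uz vz fz gz
        * hvdet n n u v (\<lambda>i. \<psi> (u i) (v i) (f i) (g i)) (\<lambda>i. \<phi> (u i) (v i) (f i) (g i))"
    for n and u v f g :: "nat \<Rightarrow> 'a"
  proof -
    define N where "N = (n + p) + (n + q)"
    define U V F G where "U = vconcat (2 * n) u uz" and "V = vconcat (2 * n) v vz"
      and "F = vconcat (2 * n) f fz" and "G = vconcat (2 * n) g gz"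
    define M where "M i j = (if j < n + p then F i * (V i ^ j * U i ^ (n + p - 1 - j))
      else G i * (V i ^ (j - (n + p)) * U i ^ (n + q - 1 - (j - (n + p)))))" for i j
    define pos where "pos k j = (if j < p then k + 1 + j else n + k + 1 + j)" for k j
    define E where "E r c = (if c < n then (\<Sum>j<p + q. of_bool (r = pos c j) * y1 j)
      else if n + p \<le> c \<and> c < n + p + n then (\<Sum>j<p + q. of_bool (r = pos (c - (n + p)) j) * y2 j)
      else 0)" for r c
    define M' where "M' i c = (if c < n then V i ^ c * U i ^ (n - 1 - c) * \<phi> (U i) (V i) (F i) (G i)
      else if n + p \<le> c \<and> c < n + p + n
      then V i ^ (c - (n + p)) * U i ^ (n - 1 - (c - (n + p))) * \<psi> (U i) (V i) (F i) (G i)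
      else M i c)" for i c
    have N_eq: "N = 2 * n + (p + q)" by (simp add: N_def)
    have pos_less: "pos k j < N" if "k < n" "j < p + q" for k j
      using that by (auto simp: pos_def N_def)
    have M_pos: "M i (pos k j) = V i ^ k * U i ^ (n - 1 - k) * b j (U i) (V i) (F i) (G i)"
      if kj: "k < n" "j < p + q" for i k j
    proof (cases "j < p")
      case True
      then obtain e e' where "n = Suc (k + e)" "p = Suc (j + e')"
        using kj by (auto simp: less_iff_Suc_add)
      then show ?thesis by (simp add: M_def pos_def b_def power_add mult_ac)
    next
      case False
      then obtain l where l: "j = p + l" "l < q" using kj by (metis le_Suc_ex nat_add_left_cancel_less not_less)
      then obtain e e' where "n = Suc (k + e)" "q = Suc (l + e')"
        using kj by (auto simp: less_iff_Suc_add)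
      then show ?thesis using l by (simp add: M_def pos_def b_def power_add mult_ac)
    qed
    have sum_pos: "(\<Sum>r<N. M i r * (\<Sum>j<p + q. of_bool (r = pos k j) * y j))
        = V i ^ k * U i ^ (n - 1 - k) * (\<Sum>j<p + q. b j (U i) (V i) (F i) (G i) * y j)"
      if "k < n" for i k y
    proof -
      have "(\<Sum>r<N. M i r * (\<Sum>j<p + q. of_bool (r = pos k j) * y j))
          = (\<Sum>j<p + q. \<Sum>r<N. of_bool (r = pos k j) * (M i r * y j))"
        unfolding sum_distrib_left by (subst sum.swap) (simp add: mult_ac)
      also have "\<dots> = (\<Sum>j<p + q. M i (pos k j) * y j)"
      proof (rule sum.cong[OF refl])
        fix j assume "j \<in> {..<p + q}"
        then have "pos k j \<in> {..<N}" using pos_less that by simp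
        then show "(\<Sum>r<N. of_bool (r = pos k j) * (M i r * y j)) = M i (pos k j) * y j"
          by (subst sum.remove[of _ "pos k j"]) (auto intro!: sum.neutral)
      qed
      also have "\<dots> = V i ^ k * U i ^ (n - 1 - k) * (\<Sum>j<p + q. b j (U i) (V i) (F i) (G i) * y j)"
        unfolding sum_distrib_left using that by (intro sum.cong) (auto simp: M_pos mult_ac)
      finally show ?thesis .
    qed
    have "fdet N M' = fdet N (\<lambda>i c. M i c + (\<Sum>r<N. M i r * E r c))"
    proof (rule fdet_cong)
      fix i c
      consider "c < n" | k where "c = n + p + k" "k < n" | "n \<le> c" "\<not> (n + p \<le> c \<and> c < n + p + n)"
        by (metis le_Suc_ex nat_add_left_cancel_less not_less)
      then show "M' i c = M i c + (\<Sum>r<N. M i r * E r c)"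
      proof cases
        case 1
        then obtain e where "n = Suc (c + e)" by (auto simp: less_iff_Suc_add)
        then show ?thesis using 1 sum_pos[of c i y1]
          by (simp add: M'_def E_def M_def \<phi>_def power_add algebra_simps)
      next
        case 2
        then obtain e where "n = Suc (k + e)" by (auto simp: less_iff_Suc_add)
        then show ?thesis using 2 sum_pos[of k i y2]
          by (simp add: M'_def E_def M_def \<psi>_def power_add algebra_simps)
      next
        case 3
        then show ?thesis by (auto simp: M'_def E_def)
      qed
    qed
    also have "\<dots> = fdet N M"
    \<comment> \<open>Columns are ranked by their position inside their own block: sources may lie
      in either block, but always at a later position than the target.\<close>
    proof (rule fdet_col_operations[where \<rho> = "\<lambda>c. N - (if c < n + p then c else c - (n + p))"])
      fix r c
      assume *: "r < N" "c < N" "N - (if c < n + p then c else c - (n + p)) \<le> N - (if r < n + p then r else r - (n + p))"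
      have "r \<noteq> pos c j" if "c < n" "j < p + q" for j
        using * that by (auto simp: pos_def split: if_splits)
      moreover have "r \<noteq> pos (c - (n + p)) j" if "n + p \<le> c" "c < n + p + n" "j < p + q" for j
        using * that by (auto simp: pos_def split: if_splits)
      ultimately show "E r c = 0" by (auto simp: E_def intro!: sum.neutral)
    qed
    finally have "fdet N M = fdet N M'" ..
    \<comment> \<open>One exchange of blocks yields the order \<psi>-columns, \<phi>-columns,
      unchanged columns; hence \<psi> becomes the first weight.\<close>
    also have "\<dots> = (-1) ^ ((n + p) * n) * fdet N (\<lambda>i j. M' i
        (if j < n then j + (n + p) else if j < (n + p) + n then j - n else j))" (is "_ = _ * fdet N ?H")
      by (rule fdet_swap_initial_col_blocks) (simp add: N_def)
    also have "fdet N ?H = fdet (2 * n) ?H * fdet (p + q) (\<lambda>i j. ?H (2 * n + i) (2 * n + j))"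
      unfolding N_eq
    proof (rule fdet_block_lower_left_zero)
      fix i j assume ij: "i < p + q" "j < 2 * n"
      have "\<phi> (uz i) (vz i) (fz i) (gz i) = 0" "\<psi> (uz i) (vz i) (fz i) (gz i) = 0"
        using y1 y2 ij(1) by (auto simp: \<phi>_def \<psi>_def)
      then show "?H (2 * n + i) j = 0"
        using ij(2) by (auto simp: M'_def U_def V_def F_def G_def vconcat_def)
    qed
    also have "fdet (2 * n) ?H
        = hvdet n n u v (\<lambda>i. \<psi> (u i) (v i) (f i) (g i)) (\<lambda>i. \<phi> (u i) (v i) (f i) (g i))"
      unfolding hvdet_def mult_2
      by (rule fdet_cong) (auto simp: M'_def U_def V_def F_def G_def vconcat_def mult_ac)
    also have "fdet (p + q) (\<lambda>i j. ?H (2 * n + i) (2 * n + j)) = fdet (p + q) (\<lambda>i j. vz i ^ n *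
        (if j < p then fz i * (vz i ^ j * uz i ^ (p - 1 - j))
         else gz i * (vz i ^ (j - p) * uz i ^ (q - 1 - (j - p)))))"
    proof (rule fdet_cong)
      fix i j assume "j < p + q"
      show "?H (2 * n + i) (2 * n + j) = vz i ^ n *
        (if j < p then fz i * (vz i ^ j * uz i ^ (p - 1 - j))
         else gz i * (vz i ^ (j - p) * uz i ^ (q - 1 - (j - p))))"
      proof (cases "j < p")
        case True
        then show ?thesis
          by (simp add: M'_def M_def U_def V_def F_def G_def vconcat_def power_add mult_ac)
      next
        case False
        then obtain l where "j = p + l" by (metis le_Suc_ex not_less)
        then show ?thesis
          by (simp add: M'_def M_def U_def V_def F_def G_def vconcat_def power_add mult_ac)
      qed
    qed
    also have "\<dots> = (\<Prod>i<p + q. vz i) ^ n * hvdet p q uz vz fz gz"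
      unfolding fdet_scale_rows by (simp add: hvdet_def prod_power_distrib)
    finally show ?thesis
      unfolding hvdet_def[of "n + p" "n + q"] N_def[symmetric] U_def[symmetric] V_def[symmetric]
        F_def[symmetric] G_def[symmetric] M_def[symmetric] by (simp add: mult_ac)
  qed
  then show ?thesis by (rule that)
qed

lemma vcons2_eq_vconcat: "vcons2 y1 y2 v = vconcat (2 * 1) (\<lambda>k. if k = 0 then y1 else y2) v"
  by (auto simp: vcons2_def vconcat_def fun_eq_iff)

lemma pfaffian_hvdet_generic:
  fixes u v f g h k uz vz fz gz uw vw hw kw :: "nat \<Rightarrow> 'a::field_char_0"
  assumes "n \<ge> 1"
    and D: "\<And>i j. i < 2 * n \<Longrightarrow> j < 2 * n \<Longrightarrow> i \<noteq> j \<Longrightarrow> u i * v j - u j * v i \<noteq> 0"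
    and z: "\<And>i. i < p + q \<Longrightarrow> vz i \<noteq> 0" "hvdet p q uz vz fz gz \<noteq> 0"
    and w: "\<And>i. i < r + s \<Longrightarrow> vw i \<noteq> 0" "hvdet r s uw vw hw kw \<noteq> 0"
  shows "pfaffian n (\<lambda>i j.
      hvdet (1 + p) (1 + q) (vcons2 (u i) (u j) uz) (vcons2 (v i) (v j) vz) (vcons2 (f i) (f j) fz) (vcons2 (g i) (g j) gz)
    * hvdet (1 + r) (1 + s) (vcons2 (u i) (u j) uw) (vcons2 (v i) (v j) vw) (vcons2 (h i) (h j) hw) (vcons2 (k i) (k j) kw)
    / (u i * v j - u j * v i))
    = 1 / pairprod (2 * n) (\<lambda>i j. u i * v j - u j * v i)
      * hvdet p q uz vz fz gz ^ (n - 1) * hvdet r s uw vw hw kw ^ (n - 1)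
      * hvdet (n + p) (n + q) (vconcat (2 * n) u uz) (vconcat (2 * n) v vz) (vconcat (2 * n) f fz) (vconcat (2 * n) g gz)
      * hvdet (n + r) (n + s) (vconcat (2 * n) u uw) (vconcat (2 * n) v vw) (vconcat (2 * n) h hw) (vconcat (2 * n) k kw)"
    (is "?lhs = ?rhs")
proof -
  let ?Hz = "hvdet p q uz vz fz gz" and ?Hw = "hvdet r s uw vw hw kw"
  define Pz Pw where "Pz = (\<Prod>i<p + q. vz i)" and "Pw = (\<Prod>i<r + s. vw i)"
  \<comment> \<open>The same \<phi> and \<psi> serve every size: size 1 turns the Pfaffian entries
    into 2 x 2 determinants of the new weights, size n treats the right-hand side.\<close>
  obtain \<phi> \<psi> :: "'a \<Rightarrow> 'a \<Rightarrow> 'a \<Rightarrow> 'a \<Rightarrow> 'a" where red: "\<And>n u v f g.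
      hvdet (n + p) (n + q) (vconcat (2 * n) u uz) (vconcat (2 * n) v vz) (vconcat (2 * n) f fz) (vconcat (2 * n) g gz)
      = (-1) ^ (n * (n + p)) * Pz ^ n * ?Hz
        * hvdet n n u v (\<lambda>i. \<psi> (u i) (v i) (f i) (g i)) (\<lambda>i. \<phi> (u i) (v i) (f i) (g i))"
    unfolding Pz_def by (rule hvdet_reduce[OF z]) blast+
  obtain \<phi>' \<psi>' :: "'a \<Rightarrow> 'a \<Rightarrow> 'a \<Rightarrow> 'a \<Rightarrow> 'a" where red': "\<And>n u v h k.
      hvdet (n + r) (n + s) (vconcat (2 * n) u uw) (vconcat (2 * n) v vw) (vconcat (2 * n) h hw) (vconcat (2 * n) k kw)
      = (-1) ^ (n * (n + r)) * Pw ^ n * ?Hw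
        * hvdet n n u v (\<lambda>i. \<psi>' (u i) (v i) (h i) (k i)) (\<lambda>i. \<phi>' (u i) (v i) (h i) (k i))"
    unfolding Pw_def by (rule hvdet_reduce[OF w]) blast+
  define a b where "a = (\<lambda>i. \<psi> (u i) (v i) (f i) (g i))" and "b = (\<lambda>i. \<phi> (u i) (v i) (f i) (g i))"
  define a' b' where "a' = (\<lambda>i. \<psi>' (u i) (v i) (h i) (k i))" and "b' = (\<lambda>i. \<phi>' (u i) (v i) (h i) (k i))"
  define C where "C = ((-1) ^ (1 + p) * Pz * ?Hz) * ((-1) ^ (1 + r) * Pw * ?Hw)"
  have "?lhs = pfaffian n (\<lambda>i j. C * ((a i * b j - a j * b i) * (a' i * b' j - a' j * b' i) / (u i * v j - u j * v i)))"
    unfolding vcons2_eq_vconcat red red' hvdet_1_1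
    by (simp add: C_def a_def b_def a'_def b'_def mult_ac)
  also have "\<dots> = C ^ n * (hvdet n n u v a b * hvdet n n u v a' b'
      / pairprod (2 * n) (\<lambda>i j. u i * v j - u j * v i))"
    unfolding pfaffian_scale by (subst pfaffian_hvdet_core[OF D]) auto
  also have "\<dots> = ?rhs"
  proof -
    \<comment> \<open>The exponents n(1 + p) and n(n + p) differ by the even number n(n -
      1).\<close>
    have sign: "((-1) ^ (1 + p)) ^ n = ((-1) ^ (n * (n + p)) :: 'a)" for p
      unfolding power_mult[symmetric] by (auto simp: minus_one_power_iff)
    \<comment> \<open>Of the n small determinants extracted from the Pfaffian, one is absorbed into
      the large determinant; the others give the exponent n - 1 of the theorem.\<close>
    have pow: "X ^ n = X ^ (n - 1) * X" for X :: 'a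
      using \<open>n \<ge> 1\<close> by (metis Suc_diff_1 less_eq_Suc_le One_nat_def power_Suc2)
    have "C ^ n = ((-1) ^ (n * (n + p)) * Pz ^ n * (?Hz ^ (n - 1) * ?Hz))
        * ((-1) ^ (n * (n + r)) * Pw ^ n * (?Hw ^ (n - 1) * ?Hw))"
      unfolding C_def power_mult_distrib sign pow[of ?Hz] pow[of ?Hw] ..
    then show ?thesis
      unfolding red red' by (simp add: a_def b_def a'_def b'_def mult_ac)
  qed
  finally show ?thesis .
qed

subsection \<open>Passage to arbitrary \<open>z\<close> and \<open>w\<close>\<close>

text \<open>As a property of functions, this spares lifting determinants and Pfaffians to a
  polynomial ring.\<close>

definition polyfun :: "('a::comm_ring_1 \<Rightarrow> 'a) \<Rightarrow> bool" where
  "polyfun F \<longleftrightarrow> (\<exists>P. \<forall>t. F t = poly P t)"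

lemma polyfun_const: "polyfun (\<lambda>_. c)"
  unfolding polyfun_def by (rule exI[of _ "[:c:]"]) simp

lemma polyfun_id: "polyfun (\<lambda>t. t)"
  unfolding polyfun_def by (rule exI[of _ "[:0, 1:]"]) simp

lemma polyfun_add: "polyfun F \<Longrightarrow> polyfun G \<Longrightarrow> polyfun (\<lambda>t. F t + G t)"
  unfolding polyfun_def by (metis poly_add)

lemma polyfun_mult: "polyfun F \<Longrightarrow> polyfun G \<Longrightarrow> polyfun (\<lambda>t. F t * G t)"
  unfolding polyfun_def by (metis poly_mult)

lemma polyfun_power: "polyfun F \<Longrightarrow> polyfun (\<lambda>t. F t ^ k)"
  unfolding polyfun_def by (metis poly_power)

lemma polyfun_divide: "polyfun F \<Longrightarrow> polyfun (\<lambda>t. F t / c)" for c :: "'a::field"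
  using polyfun_mult[OF _ polyfun_const[of "inverse c"]] by (simp add: divide_inverse)

lemma polyfun_sum: "(\<And>i. i \<in> S \<Longrightarrow> polyfun (F i)) \<Longrightarrow> polyfun (\<lambda>t. \<Sum>i\<in>S. F i t)"
  by (induction S rule: infinite_finite_induct) (auto intro: polyfun_const polyfun_add)

lemma polyfun_prod: "(\<And>i. i \<in> S \<Longrightarrow> polyfun (F i)) \<Longrightarrow> polyfun (\<lambda>t. \<Prod>i\<in>S. F i t)"
  by (induction S rule: infinite_finite_induct) (auto intro: polyfun_const polyfun_mult)

lemma polyfun_if: "polyfun F \<Longrightarrow> polyfun G \<Longrightarrow> polyfun (\<lambda>t. if b then F t else G t)"
  by (cases b) simp_all

lemma polyfun_hvdet:
  assumes "\<And>i. polyfun (\<lambda>t. u t i)" "\<And>i. polyfun (\<lambda>t. v t i)"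
    "\<And>i. polyfun (\<lambda>t. f t i)" "\<And>i. polyfun (\<lambda>t. g t i)"
  shows "polyfun (\<lambda>t. hvdet p q (u t) (v t) (f t) (g t))"
  unfolding hvdet_def fdet_rows
  by (intro polyfun_sum polyfun_mult polyfun_const polyfun_prod polyfun_if polyfun_power assms)

lemma polyfun_pfaffian:
  assumes "\<And>i j. polyfun (\<lambda>t. A t i j)"
  shows "polyfun (\<lambda>t. pfaffian n (A t))"
  unfolding pfaffian_def
  by (intro polyfun_divide polyfun_sum polyfun_mult polyfun_const polyfun_prod assms)

lemma polyfun_vconcat: "(\<And>i. polyfun (\<lambda>t. v t i)) \<Longrightarrow> polyfun (\<lambda>t. vconcat m u (v t) i)"
  unfolding vconcat_def by (intro polyfun_if polyfun_const)

lemma polyfun_vcons2: "(\<And>i. polyfun (\<lambda>t. v t i)) \<Longrightarrow> polyfun (\<lambda>t. vcons2 y1 y2 (v t) i)"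
  unfolding vcons2_def by (intro polyfun_if polyfun_const)

text \<open>The product of H and F - G vanishes also at the zeros of H. Over an infinite field it is
  then the zero polynomial, and the nonzero factor H can be cancelled.\<close>

lemma polyfun_eq:
  fixes F G H :: "'a::field_char_0 \<Rightarrow> 'a"
  assumes "polyfun F" "polyfun G" "polyfun H" "H t1 \<noteq> 0" "\<And>t. H t \<noteq> 0 \<Longrightarrow> F t = G t"
  shows "F t = G t"
proof -
  obtain P Q R where P: "\<And>t. F t = poly P t" and Q: "\<And>t. G t = poly Q t" and R: "\<And>t. H t = poly R t"
    using assms(1-3) unfolding polyfun_def by blast
  have "poly (R * (P - Q)) t = 0" for t
    using assms(5)[of t] by (auto simp: P Q R)
  then have "R * (P - Q) = 0" by (metis poly_all_0_iff_0)
  moreover have "R \<noteq> 0" using assms(4) R by auto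
  ultimately show ?thesis by (simp add: P Q)
qed

lemma sum_lessThan_add: "(\<Sum>j<p + q. F j) = (\<Sum>j<p. F j) + (\<Sum>j<q. F (p + j))"
  for F :: "nat \<Rightarrow> 'a::comm_monoid_add"
  by (induction q) (auto simp: add.assoc)

text \<open>The weights make the matrix block triangular. A kernel vector is then a pair of
  coefficient lists of binary forms: the first p rows annihilate one list, and the last q rows
  annihilate the other. The integers from 2 on are nonzero and distinct, and no two have product 1,
  so their points are pairwise nonproportional.\<close>

lemma hvdet_nonzero_example:
  "hvdet p q (\<lambda>i. 1 + (of_nat (i + 2))\<^sup>2) (\<lambda>i. of_nat (i + 2)) (\<lambda>_. 1)
    (\<lambda>i. if i < p then 0 else 1) \<noteq> (0::'a::field_char_0)"
proof
  define e :: "nat \<Rightarrow> 'a" where "e i = of_nat (i + 2)" for i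
  assume "hvdet p q (\<lambda>i. 1 + (of_nat (i + 2))\<^sup>2) (\<lambda>i. of_nat (i + 2)) (\<lambda>_. 1)
    (\<lambda>i. if i < p then 0 else 1) = (0::'a)"
  then have "fdet (p + q) (\<lambda>i j. if j < p then 1 * (e i ^ j * (1 + (e i)\<^sup>2) ^ (p - 1 - j))
      else (if i < p then 0 else 1) * (e i ^ (j - p) * (1 + (e i)\<^sup>2) ^ (q - 1 - (j - p)))) = 0"
    by (simp only: hvdet_def e_def)
  then obtain y j where y: "j < p + q" "y j \<noteq> 0" "\<And>i. i < p + q \<Longrightarrow>
      (\<Sum>j<p + q. (if j < p then 1 * (e i ^ j * (1 + (e i)\<^sup>2) ^ (p - 1 - j))
      else (if i < p then 0 else 1) * (e i ^ (j - p) * (1 + (e i)\<^sup>2) ^ (q - 1 - (j - p)))) * y j) = 0"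
    by (rule fdet_zero_kernel) blast
  have row: "(\<Sum>j<p. y j * e i ^ j * (1 + (e i)\<^sup>2) ^ (p - 1 - j))
      + (if i < p then 0 else 1) * (\<Sum>j<q. y (p + j) * e i ^ j * (1 + (e i)\<^sup>2) ^ (q - 1 - j)) = 0"
    if "i < p + q" for i
    using y(3)[OF that] unfolding sum_lessThan_add by (simp add: mult_ac sum_distrib_left)
  have nonprop: "e i * (1 + (e j)\<^sup>2) \<noteq> e j * (1 + (e i)\<^sup>2)" if "i \<noteq> j" for i j
  proof
    assume "e i * (1 + (e j)\<^sup>2) = e j * (1 + (e i)\<^sup>2)"
    then have "(e i - e j) * (e i * e j - 1) = 0" by (simp add: algebra_simps power2_eq_square)
    moreover have "e i \<noteq> e j" using that by (simp add: e_def)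
    ultimately have "e i * e j = 1" by simp
    then have "of_nat ((i + 2) * (j + 2)) = (of_nat 1 :: 'a)"
      by (simp only: e_def of_nat_mult of_nat_1)
    then show False unfolding of_nat_eq_iff by simp
  qed
  have yp: "y j = 0" if "j < p" for j
  proof (rule hom2_sum_coefficients_zero[where c = y and I = "{..<p}" and m = "p - 1" and a = e and b = "\<lambda>i. 1 + (e i)\<^sup>2"])
    have "{..p - 1} = {..<p}" using that by auto
    then show "(\<Sum>k\<le>p - 1. y k * e i ^ k * (1 + (e i)\<^sup>2) ^ (p - 1 - k)) = 0" if "i \<in> {..<p}" for i
      using row[of i] that by simp
  qed (use that nonprop in auto)
  have yq: "y (p + j) = 0" if "j < q" for j
  proof (rule hom2_sum_coefficients_zero[where c = "\<lambda>k. y (p + k)" and I = "{p..<p + q}" and m = "q - 1" and a = e and b = "\<lambda>i. 1 + (e i)\<^sup>2"])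
    have "{..q - 1} = {..<q}" using that by auto
    then show "(\<Sum>k\<le>q - 1. y (p + k) * e i ^ k * (1 + (e i)\<^sup>2) ^ (q - 1 - k)) = 0" if "i \<in> {p..<p + q}" for i
      using row[of i] that yp by simp
  qed (use that nonprop in auto)
  show False
  proof (cases "j < p")
    case False
    then have "j - p < q" using y(1) by linarith
    then show False using yq[of "j - p"] y(2) False by simp
  qed (use yp y(2) in simp)
qed

lemma vconcat_map: "vconcat m (\<lambda>i. F (u i)) (\<lambda>i. F (v i)) = (\<lambda>i. F (vconcat m u v i))"
  by (auto simp: vconcat_def fun_eq_iff)

lemma vcons2_map: "vcons2 (F y1) (F y2) (\<lambda>i. F (v i)) = (\<lambda>i. F (vcons2 y1 y2 v i))"
  by (auto simp: vcons2_def fun_eq_iff)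

theorem mainTheorem2:
  fixes n p q r s :: nat
    and x a b z c w d :: "nat \<Rightarrow> 'a::field_char_0"
  assumes "n \<ge> 1"
    and "\<And>i j. i < 2*n \<Longrightarrow> j < 2*n \<Longrightarrow> i \<noteq> j \<Longrightarrow> x i \<noteq> x j"
    and "\<And>i j. i < 2*n \<Longrightarrow> j < 2*n \<Longrightarrow> i \<noteq> j \<Longrightarrow> x i * x j \<noteq> 1"
  shows "pfaffian n (\<lambda>i j. if i = j then 0 else
            Ffun (p+1) (q+1) (vcons2 (x i) (x j) z) (vcons2 (a i) (a j) c)
          * Ffun (r+1) (s+1) (vcons2 (x i) (x j) w) (vcons2 (b i) (b j) d)
          / ((x j - x i) * (1 - x i * x j)))
       = 1 / (\<Prod>j<2*n. \<Prod>i<j. (x j - x i) * (1 - x i * x j))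
         * Ffun p q z c ^ (n - 1) * Ffun r s w d ^ (n - 1)
         * Ffun (n+p) (n+q) (vconcat (2*n) x z) (vconcat (2*n) a c)
         * Ffun (n+r) (n+s) (vconcat (2*n) x w) (vconcat (2*n) b d)"
proof -
  define \<nu> where "\<nu> y = 1 + y\<^sup>2" for y :: 'a
  \<comment> \<open>The given data sit at t = 0, and the nonvanishing example at t = 1.\<close>
  define line where "line y y' t = y + t * (y' - y)" for y y' t :: 'a
  define zt where "zt t i = line (z i) (of_nat (i + 2)) t" for t i
  define wt where "wt t i = line (w i) (of_nat (i + 2)) t" for t i
  define ct where "ct t i = line (c i) (if i < p then 0 else 1) t" for t i
  define dt where "dt t i = line (d i) (if i < r then 0 else 1) t" for t i
  define H where "H p q x a = hvdet p q (\<lambda>i. \<nu> (x i)) x (\<lambda>_. 1) a" for p q and x a :: "nat \<Rightarrow> 'a"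
  have F: "Ffun p q x a = H p q x a" for p q and x a :: "nat \<Rightarrow> 'a"
    by (simp add: Ffun_eq_hvdet H_def \<nu>_def)
  have D: "\<nu> (x i) * x j - \<nu> (x j) * x i = (x j - x i) * (1 - x i * x j)" for i j
    by (simp add: \<nu>_def algebra_simps power2_eq_square)
  \<comment> \<open>The variables x, a, b do not move, so all denominators are constant in
    t.\<close>
  define L where "L t = pfaffian n (\<lambda>i j.
      H (1 + p) (1 + q) (vcons2 (x i) (x j) (zt t)) (vcons2 (a i) (a j) (ct t))
    * H (1 + r) (1 + s) (vcons2 (x i) (x j) (wt t)) (vcons2 (b i) (b j) (dt t))
    / (\<nu> (x i) * x j - \<nu> (x j) * x i))" for t
  define R where "R t = 1 / pairprod (2 * n) (\<lambda>i j. \<nu> (x i) * x j - \<nu> (x j) * x i)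
      * H p q (zt t) (ct t) ^ (n - 1) * H r s (wt t) (dt t) ^ (n - 1)
      * H (n + p) (n + q) (vconcat (2 * n) x (zt t)) (vconcat (2 * n) a (ct t))
      * H (n + r) (n + s) (vconcat (2 * n) x (wt t)) (vconcat (2 * n) b (dt t))" for t
  \<comment> \<open>This product collects every genericity condition on z, w, c, d; its nonvanishing
    is what the generic case requires.\<close>
  define G where "G t = (\<Prod>i<p + q. zt t i) * H p q (zt t) (ct t)
      * ((\<Prod>i<r + s. wt t i) * H r s (wt t) (dt t))" for t
  have line: "polyfun (\<lambda>t. line y y' t)" for y y'
    unfolding line_def by (intro polyfun_add polyfun_mult polyfun_const polyfun_id)
  have vars: "polyfun (\<lambda>t. zt t i)" "polyfun (\<lambda>t. wt t i)" "polyfun (\<lambda>t. ct t i)" "polyfun (\<lambda>t. dt t i)" for i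
    unfolding zt_def wt_def ct_def dt_def by (rule line)+
  have polyH: "polyfun (\<lambda>t. H p q (x t) (a t))"
    if "\<And>i. polyfun (\<lambda>t. x t i)" "\<And>i. polyfun (\<lambda>t. a t i)" for p q and x a :: "'a \<Rightarrow> nat \<Rightarrow> 'a"
    unfolding H_def \<nu>_def by (intro polyfun_hvdet polyfun_add polyfun_const polyfun_power that)
  have "L t = R t" for t
  proof (rule polyfun_eq[where F = L and G = R and H = G])
    show "polyfun L" unfolding L_def
      by (intro polyfun_pfaffian polyfun_divide polyfun_mult polyH polyfun_vcons2 vars)
    show "polyfun R" unfolding R_def
      by (intro polyfun_mult polyfun_const polyfun_power polyH polyfun_vconcat vars)
    show "polyfun G" unfolding G_def by (intro polyfun_mult polyfun_prod polyH vars)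
    have "zt 1 = (\<lambda>i. of_nat (i + 2))" "wt 1 = (\<lambda>i. of_nat (i + 2))"
      "ct 1 = (\<lambda>i. if i < p then 0 else 1)" "dt 1 = (\<lambda>i. if i < r then 0 else 1)"
      by (auto simp: zt_def wt_def ct_def dt_def line_def)
    moreover have "of_nat (i + 2) \<noteq> (0::'a)" for i unfolding of_nat_eq_0_iff by simp
    ultimately show "G 1 \<noteq> 0"
      using hvdet_nonzero_example[of p q, where 'a = 'a] hvdet_nonzero_example[of r s, where 'a = 'a]
      unfolding G_def H_def \<nu>_def by (simp only: mult_eq_0_iff prod_zero_iff[OF finite_lessThan]) blast
    show "L t = R t" if "G t \<noteq> 0" for t
    proof -
      have nz: "zt t i \<noteq> 0" if "i < p + q" for i
        using \<open>G t \<noteq> 0\<close> that by (auto simp: G_def)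
      have nz': "wt t i \<noteq> 0" if "i < r + s" for i
        using \<open>G t \<noteq> 0\<close> that by (auto simp: G_def)
      have one: "vconcat m (\<lambda>_. 1) (\<lambda>_. 1) = (\<lambda>_. 1)" "vcons2 1 1 (\<lambda>_. 1) = (\<lambda>_. 1)" for m
        by (auto simp: vconcat_def vcons2_def)
      have "\<nu> (x i) * x j - \<nu> (x j) * x i \<noteq> 0" if "i < 2 * n" "j < 2 * n" "i \<noteq> j" for i j
        unfolding D using assms(2)[OF that(2,1)] assms(3)[OF that] that(3) by auto
      moreover have "hvdet p q (\<lambda>i. \<nu> (zt t i)) (zt t) (\<lambda>_. 1) (ct t) \<noteq> 0"
        "hvdet r s (\<lambda>i. \<nu> (wt t i)) (wt t) (\<lambda>_. 1) (dt t) \<noteq> 0"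
        using \<open>G t \<noteq> 0\<close> by (auto simp: G_def H_def)
      ultimately show ?thesis
        using pfaffian_hvdet_generic[OF \<open>n \<ge> 1\<close>, of "\<lambda>i. \<nu> (x i)" x p q "zt t" "\<lambda>i. \<nu> (zt t i)" "\<lambda>_. 1" "ct t"
          r s "wt t" "\<lambda>i. \<nu> (wt t i)" "\<lambda>_. 1" "dt t" "\<lambda>_. 1" a "\<lambda>_. 1" b] nz nz'
        unfolding L_def R_def H_def vconcat_map vcons2_map one by blast
    qed
  qed
  moreover have "zt 0 = z" "wt 0 = w" "ct 0 = c" "dt 0 = d"
    by (auto simp: zt_def wt_def ct_def dt_def line_def)
  ultimately have "L 0 = R 0" "zt 0 = z" "wt 0 = w" "ct 0 = c" "dt 0 = d" by blast+
  then have main: "pfaffian n (\<lambda>i j.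
      H (1 + p) (1 + q) (vcons2 (x i) (x j) z) (vcons2 (a i) (a j) c)
    * H (1 + r) (1 + s) (vcons2 (x i) (x j) w) (vcons2 (b i) (b j) d)
    / ((x j - x i) * (1 - x i * x j))) = 1 / pairprod (2 * n) (\<lambda>i j. (x j - x i) * (1 - x i * x j))
      * H p q z c ^ (n - 1) * H r s w d ^ (n - 1)
      * H (n + p) (n + q) (vconcat (2 * n) x z) (vconcat (2 * n) a c)
      * H (n + r) (n + s) (vconcat (2 * n) x w) (vconcat (2 * n) b d)"
    unfolding L_def R_def D by (simp only:)
  \<comment> \<open>Only off-diagonal entries matter, so the case distinction on
    \<open>i = j\<close> may be dropped.\<close>
  show ?thesis
    unfolding F using main
    by (subst pfaffian_cong[where B = "\<lambda>i j.
      H (1 + p) (1 + q) (vcons2 (x i) (x j) z) (vcons2 (a i) (a j) c)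
    * H (1 + r) (1 + s) (vcons2 (x i) (x j) w) (vcons2 (b i) (b j) d)
    / ((x j - x i) * (1 - x i * x j))"]) (simp_all add: pairprod_def add.commute)
qed

end
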